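(* Let $A$ be a commutative ring with identity, and let $B=\{(f(X),a)\in A[X]\times A \mid f(0)=f(1)=a\}$, i.e. $B$ is the fibre product of $\delta: A[X]\to A\oplus A$, $\delta(f(X))=(f(0),f(1))$, and $\Delta: A\to A\oplus A$, $\Delta(a)=(a,a)$. Then the following sequence is exact: $$\pi_1(SL_2(B)) \xrightarrow{\Psi_1}\pi_1(SL_2(A[X]))\oplus \pi_1(SL_2(A)) \xrightarrow{\Psi_2}\pi_1(SL_2(A\oplus A)) \xrightarrow{\chi} \Gamma(B)\xrightarrow{\Phi_1} \Gamma(A[X])\oplus \Gamma(A)\xrightarrow{\Phi_2} \Gamma(A\oplus A),$$ where $$\Psi_1([\alpha(X)(T), \beta(T)])=([\alpha(X)(T)], [\beta(T)]),$$ $$\Psi_2([\alpha(X)(T)], [\beta(T)])=([\alpha(0)(T)\beta(T)^{-1}], [\alpha(1)(T)\beta(T)^{-1}]),$$ $$\chi([\alpha(T)],[\beta(T)])=[M(X,1),I_2],$$ $$\Phi_1([\alpha(X), \beta])=([\alpha(X)], [\beta]),$$ $$\Phi_2([\alpha(X)], [\beta])=([\alpha(0)\beta^{-1}], [\alpha(1)\beta^{-1}]),$$ and where, in the definition of $\chi$, $M(X,T)=\alpha((1-X)T)\,\beta(XT)\in SL_2(A[X,T])$.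
   Context: All rings are commutative with identity; $I_2$ is the $2\times 2$ identity matrix. For a ring $R$, a loop in $SL_2(R)$ is a matrix $\alpha(T)\in SL_2(R[T])$ with $\alpha(0)=\alpha(1)=I_2$. Two loops $\alpha(T),\beta(T)$ are equivalent if there is $\gamma(T,S)\in SL_2(R[T,S])$ with $\gamma(T,0)=\alpha(T)$, $\gamma(T,1)=\beta(T)$, $\gamma(0,S)=\gamma(1,S)=I_2$. The set $\pi_1(SL_2(R))$ of equivalence classes of loops is an abelian group under $[\alpha(T)]*[\beta(T)]=[\alpha(T)\beta(T)]$ (the algebraic fundamental group of $R$). Let $QL_2(R)$ be the normal subgroup of all $\alpha\in SL_2(R)$ connected to the identity, i.e. such that there is $\beta(T)\in SL_2(R[T])$ with $\beta(0)=I_2$, $\beta(1)=\alpha$. The algebraic cohomotopy group of $R$ is $\Gamma(R)=SL_2(R)/QL_2(R)$. (Equivalently, it is the set of classes of unimodular rows $(a,b)\in R^2$ under: $(a,b)\sim(c,d)$ if $\alpha (a,b)^t=(c,d)^t$ for some $\alpha\in QL_2(R)$; the product is the class of the first column of the product of completions in $SL_2(R)$.) $SL_2(B)$ is identified with the set of pairs $(\alpha(X),\beta)\in SL_2(A[X])\times SL_2(A)$ with $\alpha(0)=\alpha(1)=\beta$, and similarly $SL_2(B[T])$ with pairs $(\alpha(X)(T),\beta(T))\in SL_2(A[X][T])\times SL_2(A[T])$ with $\alpha(0)(T)=\alpha(1)(T)=\beta(T)$. Here $\alpha(X)(T)$ denotes a matrix over $A[X][T]$, and $\alpha(0)(T),\alpha(1)(T)$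 its specializations at $X=0,1$. Also $\pi_1(SL_2(A\oplus A))$ and $\Gamma(A\oplus A)$ are identified with $\pi_1(SL_2(A))\times\pi_1(SL_2(A))$ and $\Gamma(A)\times\Gamma(A)$. Exactness at an interior term means that the image of the incoming map equals the kernel (preimage of the identity element) of the outgoing map. *)

theory Defs
  imports "HOL-Algebra.UnivPoly" "HOL-Algebra.Chinese_Remainder"
begin

datatype 'a mat2 = Mat2 'a 'a 'a 'a   \<comment> \<open>entries row by row: $a_{11}, a_{12}, a_{21}, a_{22}$\<close>

fun det2 :: "('a, 'm) ring_scheme \<Rightarrow> 'a mat2 \<Rightarrow> 'a" where
  "det2 R (Mat2 a b c d) = a \<otimes>\<^bsub>R\<^esub> d \<ominus>\<^bsub>R\<^esub> b \<otimes>\<^bsub>R\<^esub> c"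

fun mult2 :: "('a, 'm) ring_scheme \<Rightarrow> 'a mat2 \<Rightarrow> 'a mat2 \<Rightarrow> 'a mat2" where
  "mult2 R (Mat2 a b c d) (Mat2 a' b' c' d') =
     Mat2 (a \<otimes>\<^bsub>R\<^esub> a' \<oplus>\<^bsub>R\<^esub> b \<otimes>\<^bsub>R\<^esub> c') (a \<otimes>\<^bsub>R\<^esub> b' \<oplus>\<^bsub>R\<^esub> b \<otimes>\<^bsub>R\<^esub> d')
          (c \<otimes>\<^bsub>R\<^esub> a' \<oplus>\<^bsub>R\<^esub> d \<otimes>\<^bsub>R\<^esub> c') (c \<otimes>\<^bsub>R\<^esub> b' \<oplus>\<^bsub>R\<^esub> d \<otimes>\<^bsub>R\<^esub> d')"

definition SL2 :: "('a, 'm) ring_scheme \<Rightarrow> 'a mat2 monoid" where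
  "SL2 R = \<lparr>carrier = {\<alpha>. set_mat2 \<alpha> \<subseteq> carrier R \<and> det2 R \<alpha> = \<one>\<^bsub>R\<^esub>},
            monoid.mult = mult2 R,
            one = Mat2 \<one>\<^bsub>R\<^esub> \<zero>\<^bsub>R\<^esub> \<zero>\<^bsub>R\<^esub> \<one>\<^bsub>R\<^esub>\<rparr>"

fun zip_mat2 :: "('a \<Rightarrow> 'b \<Rightarrow> 'c) \<Rightarrow> 'a mat2 \<Rightarrow> 'b mat2 \<Rightarrow> 'c mat2" where
  "zip_mat2 h (Mat2 a b c d) (Mat2 a' b' c' d') = Mat2 (h a a') (h b b') (h c c') (h d d')"

text \<open>
  Polynomials in one variable over \<open>R\<close> are \<open>UP R\<close>. A polynomial in two variables is an element of
  \<open>UP (UP R)\<close>: the coefficients carry the inner variable, written first. Thus \<open>\<gamma>(T,S)\<close> over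
  \<open>R[T,S]\<close> has inner variable \<open>T\<close>, outer variable \<open>S\<close>, and \<open>\<alpha>(X)(T)\<close> over \<open>A[X][T]\<close> has inner
  variable \<open>X\<close>, outer variable \<open>T\<close>.
\<close>

definition at_outer :: "('a, 'm) ring_scheme \<Rightarrow> 'a \<Rightarrow> (nat \<Rightarrow> 'a) mat2 \<Rightarrow> 'a mat2" where
  "at_outer R r = map_mat2 (eval R R id r)"

definition at_inner ::
  "('a, 'm) ring_scheme \<Rightarrow> 'a \<Rightarrow> (nat \<Rightarrow> nat \<Rightarrow> 'a) mat2 \<Rightarrow> (nat \<Rightarrow> 'a) mat2" where
  "at_inner R r = map_mat2 (\<lambda>p n. eval R R id r (p n))"

definition loops :: "('a, 'm) ring_scheme \<Rightarrow> (nat \<Rightarrow> 'a) mat2 set" where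
  "loops R = {\<alpha> \<in> carrier (SL2 (UP R)).
     at_outer R \<zero>\<^bsub>R\<^esub> \<alpha> = \<one>\<^bsub>SL2 R\<^esub> \<and> at_outer R \<one>\<^bsub>R\<^esub> \<alpha> = \<one>\<^bsub>SL2 R\<^esub>}"

definition loop_rel :: "('a, 'm) ring_scheme \<Rightarrow> (nat \<Rightarrow> 'a) mat2 rel" where
  "loop_rel R = {(\<alpha>, \<beta>). \<alpha> \<in> loops R \<and> \<beta> \<in> loops R \<and>
     (\<exists>\<gamma> \<in> carrier (SL2 (UP (UP R))).
        at_outer (UP R) \<zero>\<^bsub>UP R\<^esub> \<gamma> = \<alpha> \<and> at_outer (UP R) \<one>\<^bsub>UP R\<^esub> \<gamma> = \<beta> \<and>
        at_inner R \<zero>\<^bsub>R\<^esub> \<gamma> = \<one>\<^bsub>SL2 (UP R)\<^esub> \<and> at_inner R \<one>\<^bsub>R\<^esub> \<gamma> = \<one>\<^bsub>SL2 (UP R)\<^esub>)}"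

definition loop_class :: "('a, 'm) ring_scheme \<Rightarrow> (nat \<Rightarrow> 'a) mat2 \<Rightarrow> (nat \<Rightarrow> 'a) mat2 set" where
  "loop_class R \<alpha> = loop_rel R `` {\<alpha>}"

definition pi1 :: "('a, 'm) ring_scheme \<Rightarrow> (nat \<Rightarrow> 'a) mat2 set monoid" where
  "pi1 R = \<lparr>carrier = loops R // loop_rel R,
            monoid.mult = (\<lambda>c d. \<Union>\<alpha>\<in>c. \<Union>\<beta>\<in>d. loop_class R (\<alpha> \<otimes>\<^bsub>SL2 (UP R)\<^esub> \<beta>)),
            one = loop_class R \<one>\<^bsub>SL2 (UP R)\<^esub>\<rparr>"

definition QL2 :: "('a, 'm) ring_scheme \<Rightarrow> 'a mat2 set" where
  "QL2 R = {\<alpha> \<in> carrier (SL2 R). \<exists>\<beta> \<in> carrier (SL2 (UP R)).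
     at_outer R \<zero>\<^bsub>R\<^esub> \<beta> = \<one>\<^bsub>SL2 R\<^esub> \<and> at_outer R \<one>\<^bsub>R\<^esub> \<beta> = \<alpha>}"

definition Gam :: "('a, 'm) ring_scheme \<Rightarrow> 'a mat2 set monoid" where
  "Gam R = SL2 R Mod QL2 R"

definition Gam_class :: "('a, 'm) ring_scheme \<Rightarrow> 'a mat2 \<Rightarrow> 'a mat2 set" where
  "Gam_class R \<alpha> = QL2 R #>\<^bsub>SL2 R\<^esub> \<alpha>"

definition B_ring :: "('a, 'm) ring_scheme \<Rightarrow> ((nat \<Rightarrow> 'a) \<times> 'a) ring" where
  "B_ring A = (RDirProd (UP A) A)
     \<lparr>carrier := {(f, a). f \<in> carrier (UP A) \<and> a \<in> carrier A \<and>
                    eval A A id \<zero>\<^bsub>A\<^esub> f = a \<and> eval A A id \<one>\<^bsub>A\<^esub> f = a}\<rparr>"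

text \<open>
  A pair of matrices is regarded as a matrix of pairs, and a pair of matrices with polynomial entries
  as a matrix whose entries are polynomials with pairs as coefficients.
\<close>

definition pair_mat :: "'a mat2 \<Rightarrow> 'b mat2 \<Rightarrow> ('a \<times> 'b) mat2" where
  "pair_mat = zip_mat2 Pair"

definition pair_pmat :: "(nat \<Rightarrow> 'a) mat2 \<Rightarrow> (nat \<Rightarrow> 'b) mat2 \<Rightarrow> (nat \<Rightarrow> 'a \<times> 'b) mat2" where
  "pair_pmat = zip_mat2 (\<lambda>p q n. (p n, q n))"

definition fst_pmat :: "(nat \<Rightarrow> 'a \<times> 'b) mat2 \<Rightarrow> (nat \<Rightarrow> 'a) mat2" where
  "fst_pmat = map_mat2 (\<lambda>p n. fst (p n))"

definition snd_pmat :: "(nat \<Rightarrow> 'a \<times> 'b) mat2 \<Rightarrow> (nat \<Rightarrow> 'b) mat2" where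
  "snd_pmat = map_mat2 (\<lambda>p n. snd (p n))"

text \<open>
  Each map is given by a formula on representatives; on classes it is the union of the resulting
  classes over all choices of representatives, so it takes the expected value exactly when the formula
  does not depend on these choices.
\<close>

definition Psi1 :: "('a, 'm) ring_scheme \<Rightarrow> (nat \<Rightarrow> (nat \<Rightarrow> 'a) \<times> 'a) mat2 set \<Rightarrow>
    (nat \<Rightarrow> nat \<Rightarrow> 'a) mat2 set \<times> (nat \<Rightarrow> 'a) mat2 set" where
  "Psi1 A c = (\<Union>\<omega>\<in>c. loop_class (UP A) (fst_pmat \<omega>), \<Union>\<omega>\<in>c. loop_class A (snd_pmat \<omega>))"

definition Psi2_rep :: "('a, 'm) ring_scheme \<Rightarrow> (nat \<Rightarrow> nat \<Rightarrow> 'a) mat2 \<Rightarrow> (nat \<Rightarrow> 'a) mat2 \<Rightarrow>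
    (nat \<Rightarrow> 'a \<times> 'a) mat2" where
  "Psi2_rep A \<alpha> \<beta> =
     pair_pmat (at_inner A \<zero>\<^bsub>A\<^esub> \<alpha> \<otimes>\<^bsub>SL2 (UP A)\<^esub> inv\<^bsub>SL2 (UP A)\<^esub> \<beta>)
               (at_inner A \<one>\<^bsub>A\<^esub> \<alpha> \<otimes>\<^bsub>SL2 (UP A)\<^esub> inv\<^bsub>SL2 (UP A)\<^esub> \<beta>)"

definition Psi2 :: "('a, 'm) ring_scheme \<Rightarrow>
    (nat \<Rightarrow> nat \<Rightarrow> 'a) mat2 set \<times> (nat \<Rightarrow> 'a) mat2 set \<Rightarrow> (nat \<Rightarrow> 'a \<times> 'a) mat2 set" where
  "Psi2 A = (\<lambda>(c, d). \<Union>\<alpha>\<in>c. \<Union>\<beta>\<in>d. loop_class (RDirProd A A) (Psi2_rep A \<alpha> \<beta>))"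

text \<open>Substitution $T \mapsto q$ in a matrix over $A[T]$, where $q \in A[X,T]$.\<close>

definition subst2 :: "('a, 'm) ring_scheme \<Rightarrow> (nat \<Rightarrow> nat \<Rightarrow> 'a) \<Rightarrow> (nat \<Rightarrow> 'a) mat2 \<Rightarrow>
    (nat \<Rightarrow> nat \<Rightarrow> 'a) mat2" where
  "subst2 A q =
     map_mat2 (eval A (UP (UP A)) (\<lambda>a. monom (UP (UP A)) (monom (UP A) a 0) 0) q)"

text \<open>$M(X,T) = \alpha((1-X)T)\,\beta(XT)$\<close>

definition chi_M :: "('a, 'm) ring_scheme \<Rightarrow> (nat \<Rightarrow> 'a) mat2 \<Rightarrow> (nat \<Rightarrow> 'a) mat2 \<Rightarrow>
    (nat \<Rightarrow> nat \<Rightarrow> 'a) mat2" where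
  "chi_M A \<alpha> \<beta> =
     (let X = monom (UP A) \<one>\<^bsub>A\<^esub> 1 in
      subst2 A (monom (UP (UP A)) (\<one>\<^bsub>UP A\<^esub> \<ominus>\<^bsub>UP A\<^esub> X) 1) \<alpha>
        \<otimes>\<^bsub>SL2 (UP (UP A))\<^esub> subst2 A (monom (UP (UP A)) X 1) \<beta>)"

definition chi_rep :: "('a, 'm) ring_scheme \<Rightarrow> (nat \<Rightarrow> 'a) mat2 \<Rightarrow> (nat \<Rightarrow> 'a) mat2 \<Rightarrow>
    ((nat \<Rightarrow> 'a) \<times> 'a) mat2" where
  "chi_rep A \<alpha> \<beta> = pair_mat (at_outer (UP A) \<one>\<^bsub>UP A\<^esub> (chi_M A \<alpha> \<beta>)) \<one>\<^bsub>SL2 A\<^esub>"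

definition chi :: "('a, 'm) ring_scheme \<Rightarrow> (nat \<Rightarrow> 'a \<times> 'a) mat2 set \<Rightarrow>
    ((nat \<Rightarrow> 'a) \<times> 'a) mat2 set" where
  "chi A c = (\<Union>\<omega>\<in>c. Gam_class (B_ring A) (chi_rep A (fst_pmat \<omega>) (snd_pmat \<omega>)))"

definition Phi1 :: "('a, 'm) ring_scheme \<Rightarrow> ((nat \<Rightarrow> 'a) \<times> 'a) mat2 set \<Rightarrow>
    (nat \<Rightarrow> 'a) mat2 set \<times> 'a mat2 set" where
  "Phi1 A c = (\<Union>\<omega>\<in>c. Gam_class (UP A) (map_mat2 fst \<omega>), \<Union>\<omega>\<in>c. Gam_class A (map_mat2 snd \<omega>))"

definition Phi2_rep :: "('a, 'm) ring_scheme \<Rightarrow> (nat \<Rightarrow> 'a) mat2 \<Rightarrow> 'a mat2 \<Rightarrow> ('a \<times> 'a) mat2" where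
  "Phi2_rep A \<alpha> \<beta> =
     pair_mat (at_outer A \<zero>\<^bsub>A\<^esub> \<alpha> \<otimes>\<^bsub>SL2 A\<^esub> inv\<^bsub>SL2 A\<^esub> \<beta>)
              (at_outer A \<one>\<^bsub>A\<^esub> \<alpha> \<otimes>\<^bsub>SL2 A\<^esub> inv\<^bsub>SL2 A\<^esub> \<beta>)"

definition Phi2 :: "('a, 'm) ring_scheme \<Rightarrow> (nat \<Rightarrow> 'a) mat2 set \<times> 'a mat2 set \<Rightarrow>
    ('a \<times> 'a) mat2 set" where
  "Phi2 A = (\<lambda>(c, d). \<Union>\<alpha>\<in>c. \<Union>\<beta>\<in>d. Gam_class (RDirProd A A) (Phi2_rep A \<alpha> \<beta>))"

text \<open>
  Not \<open>exact_seq\<close>: that notion requires homomorphisms, which \<open>Phi2\<close> need not be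
  (\<open>Gam R\<close> is not assumed abelian).
\<close>

definition exact_at :: "('a, 'm) monoid_scheme \<Rightarrow> ('b, 'n) monoid_scheme \<Rightarrow> ('c, 'k) monoid_scheme \<Rightarrow>
    ('a \<Rightarrow> 'b) \<Rightarrow> ('b \<Rightarrow> 'c) \<Rightarrow> bool" where
  "exact_at G H K f g \<longleftrightarrow>
     f \<in> carrier G \<rightarrow> carrier H \<and> g \<in> carrier H \<rightarrow> carrier K \<and> f ` carrier G = kernel H K g"

end

(*
  Everything rests on gluing. If a(T), b(T) over A[T] are trivial at T = 0, then
  M(X,T) = a((1-X)T) b(XT) is trivial at T = 0 and restricts to a at X = 0 and to b at X = 1; and a
  matrix N(X,S) with N(X,0) = 1 and N(0,S) = N(1,S) is exactly a path in SL_2(B) starting at 1.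
  Each nontrivial inclusion multiplies the given data by such an M:
    - at pi_1(A[X]) + pi_1(A): two null-homotopic loops over A are the ends X = 0, 1 of one
      null-homotopic loop over A[X] (glue in the homotopy variable), which corrects alpha(X)(T) so
      that its ends agree with beta(T);
    - at pi_1(A + A): for a loop u over A[X] with ends u_0, u_1 the path M_{u_0 a, u_1 b} M_{a,b}^-1 u^-1
      shows that chi(u_0 a, u_1 b) = chi(a, b), which also makes chi well defined; conversely, if N is
      a path in SL_2(B) to M(X,1), then the loop M N^-1 over A[X] has ends a d^-1 and b d^-1 with
      d = N(0,-) = N(1,-);
    - at Gamma(B): if N and d are paths to alpha(X) and beta, then a = d^-1 N(0,-) and b = d^-1 N(1,-)
      are loops, and M N^-1 has both ends equal to d^-1;
    - at Gamma(A[X]) + Gamma(A): paths to alpha(0) beta^-1 and alpha(1) beta^-1 glue to a path over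
      A[X] whose end point corrects alpha.
*)
theory Submission
  imports Defs
begin

section \<open>The group $SL_2$\<close>

text \<open>Homotopy classes and classes modulo \<open>QL2\<close> are both treated as cosets of a
  normal subgroup: \<open>null_loops R\<close> in SL_2(R[T]) and \<open>QL2 R\<close> in SL_2(R).
  Each is the image, under an evaluation, of a kernel or an intersection of kernels of evaluations,
  and evaluations are onto because constants split them. Coset calculus then makes every map except
  \<open>chi\<close> independent of representatives, with no commutativity assumed. The assignment
  of M(X,1) to (a, b) is not a homomorphism in general, so coset calculus does not reach
  \<open>chi\<close>; its independence comes from extending null-homotopic loops from A to A[X]. A
  second obstacle is that polynomials in several variables are nested: specialising the inner
  variable acts on coefficients, specialising the outer one is an evaluation. Naturality of
  evaluation under ring homomorphisms allows the order to be exchanged, and such identities of rings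
  are checked on constants and on T.\<close>

lemma mem_SL2 [simp]:
  "Mat2 a b c d \<in> carrier (SL2 R) \<longleftrightarrow> a \<in> carrier R \<and> b \<in> carrier R \<and> c \<in> carrier R \<and> d \<in> carrier R \<and>
     a \<otimes>\<^bsub>R\<^esub> d \<ominus>\<^bsub>R\<^esub> b \<otimes>\<^bsub>R\<^esub> c = \<one>\<^bsub>R\<^esub>"
  by (auto simp: SL2_def)

lemma SL2_mult [simp]: "x \<otimes>\<^bsub>SL2 R\<^esub> y = mult2 R x y"
  by (simp add: SL2_def)

lemma SL2_one: "\<one>\<^bsub>SL2 R\<^esub> = Mat2 \<one>\<^bsub>R\<^esub> \<zero>\<^bsub>R\<^esub> \<zero>\<^bsub>R\<^esub> \<one>\<^bsub>R\<^esub>"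
  by (simp add: SL2_def)

lemma (in cring) group_SL2: "group (SL2 R)"
proof (rule groupI)
  fix x y assume "x \<in> carrier (SL2 R)" "y \<in> carrier (SL2 R)"
  moreover obtain a b c d where x: "x = Mat2 a b c d" by (cases x)
  moreover obtain a' b' c' d' where y: "y = Mat2 a' b' c' d'" by (cases y)
  ultimately have cl: "a \<in> carrier R" "b \<in> carrier R" "c \<in> carrier R" "d \<in> carrier R"
    "a' \<in> carrier R" "b' \<in> carrier R" "c' \<in> carrier R" "d' \<in> carrier R"
    and det: "a \<otimes> d \<ominus> b \<otimes> c = \<one>" "a' \<otimes> d' \<ominus> b' \<otimes> c' = \<one>" by auto
  have "(a \<otimes> a' \<oplus> b \<otimes> c') \<otimes> (c \<otimes> b' \<oplus> d \<otimes> d') \<ominus> (a \<otimes> b' \<oplus> b \<otimes> d') \<otimes> (c \<otimes> a' \<oplus> d \<otimes> c')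
     = (a \<otimes> d \<ominus> b \<otimes> c) \<otimes> (a' \<otimes> d' \<ominus> b' \<otimes> c')"
    using cl by algebra
  then show "x \<otimes>\<^bsub>SL2 R\<^esub> y \<in> carrier (SL2 R)"
    using cl det by (simp add: x y)
next
  show "\<one>\<^bsub>SL2 R\<^esub> \<in> carrier (SL2 R)" by (simp add: SL2_one a_minus_def)
next
  fix x y z assume "x \<in> carrier (SL2 R)" "y \<in> carrier (SL2 R)" "z \<in> carrier (SL2 R)"
  then show "x \<otimes>\<^bsub>SL2 R\<^esub> y \<otimes>\<^bsub>SL2 R\<^esub> z = x \<otimes>\<^bsub>SL2 R\<^esub> (y \<otimes>\<^bsub>SL2 R\<^esub> z)"
    by (cases x; cases y; cases z; simp; intro conjI; algebra)
next
  fix x assume "x \<in> carrier (SL2 R)"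
  then show "\<one>\<^bsub>SL2 R\<^esub> \<otimes>\<^bsub>SL2 R\<^esub> x = x"
    by (cases x; simp add: SL2_one)
next
  fix x assume "x \<in> carrier (SL2 R)"
  then obtain a b c d where x: "x = Mat2 a b c d"
    and cl: "a \<in> carrier R" "b \<in> carrier R" "c \<in> carrier R" "d \<in> carrier R"
    and det: "a \<otimes> d \<ominus> b \<otimes> c = \<one>" by (cases x; auto)
  \<comment> \<open>The left inverse is the adjugate. Its product with x has the determinant on the
    diagonal and 0 elsewhere, and the last identity shows that it has the same determinant as
    x.\<close>
  have "d \<otimes> a \<oplus> \<ominus> b \<otimes> c = a \<otimes> d \<ominus> b \<otimes> c" "\<ominus> c \<otimes> b \<oplus> a \<otimes> d = a \<otimes> d \<ominus> b \<otimes> c"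
    "d \<otimes> b \<oplus> \<ominus> b \<otimes> d = \<zero>" "\<ominus> c \<otimes> a \<oplus> a \<otimes> c = \<zero>"
    "d \<otimes> a \<ominus> \<ominus> b \<otimes> \<ominus> c = a \<otimes> d \<ominus> b \<otimes> c"
    using cl by algebra+
  then show "\<exists>y\<in>carrier (SL2 R). y \<otimes>\<^bsub>SL2 R\<^esub> x = \<one>\<^bsub>SL2 R\<^esub>"
    using cl det by (intro bexI[of _ "Mat2 d (\<ominus> b) (\<ominus> c) a"]) (simp_all add: x SL2_one)
qed

lemma (in ring_hom_cring) group_hom_SL2: "group_hom (SL2 R) (SL2 S) (map_mat2 h)"
proof -
  have "map_mat2 h \<in> hom (SL2 R) (SL2 S)"
  proof (rule homI)
    fix x assume "x \<in> carrier (SL2 R)"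
    then obtain a b c d where x: "x = Mat2 a b c d"
      and cl: "a \<in> carrier R" "b \<in> carrier R" "c \<in> carrier R" "d \<in> carrier R"
      and det: "a \<otimes> d \<ominus> b \<otimes> c = \<one>" by (cases x; auto)
    have "h (a \<otimes> d \<ominus> b \<otimes> c) = \<one>\<^bsub>S\<^esub>" by (simp add: det)
    then show "map_mat2 h x \<in> carrier (SL2 S)"
      using cl by (simp add: x a_minus_def)
  next
    fix x y assume "x \<in> carrier (SL2 R)" "y \<in> carrier (SL2 R)"
    then show "map_mat2 h (x \<otimes>\<^bsub>SL2 R\<^esub> y) = map_mat2 h x \<otimes>\<^bsub>SL2 S\<^esub> map_mat2 h y"
      by (cases x; cases y; simp)
  qed
  then show ?thesis
    by (intro group_hom.intro group_hom_axioms.intro R.group_SL2 S.group_SL2)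
qed

lemmas map_SL2_hom = ring_hom_cring.group_hom_SL2 [OF ring_hom_cringI]

lemma map_mat2_SL2_cong:
  "x \<in> carrier (SL2 R) \<Longrightarrow> (\<And>a. a \<in> carrier R \<Longrightarrow> f a = g a) \<Longrightarrow> map_mat2 f x = map_mat2 g x"
  by (cases x) simp

lemma map_mat2_SL2_ident:
  "x \<in> carrier (SL2 R) \<Longrightarrow> (\<And>a. a \<in> carrier R \<Longrightarrow> f a = a) \<Longrightarrow> map_mat2 f x = x"
  by (cases x) simp

text \<open>From here on products stay folded, so that the simplifier uses group and homomorphism
  laws instead of expanding into entries.\<close>

declare SL2_mult [simp del]

section \<open>Homomorphisms of polynomial rings\<close>

text \<open>\<open>ring_hom\<close> constrains values on the carrier only, so two functions that
  agree there are homomorphisms together. This transfers the result on dilation by 1 to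
  \<open>pmap\<close>.\<close>

lemma ring_hom_cong:
  assumes "f \<in> ring_hom R S" "ring R" "\<And>x. x \<in> carrier R \<Longrightarrow> f x = g x"
  shows "g \<in> ring_hom R S"
proof -
  interpret ring R by fact
  show ?thesis using assms(1) assms(3)[symmetric] by (auto simp: ring_hom_def)
qed

lemma cring_UP: "cring R \<Longrightarrow> cring (UP R)"
  by (rule UP_cring.UP_cring) (simp add: UP_cring_def)

lemma mem_UP: "p \<in> carrier (UP R) \<longleftrightarrow> (\<forall>n. p n \<in> carrier R) \<and> (\<exists>n. \<forall>m>n. p m = \<zero>\<^bsub>R\<^esub>)"
  by (auto simp: UP_def up_def bound_def)

text \<open>Not a simp rule: the pattern \<open>p n\<close> matches every application.\<close>

lemma UP_coeff_closed: "p \<in> carrier (UP R) \<Longrightarrow> p n \<in> carrier R"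
  by (simp add: mem_UP)

lemma UP_zero_apply [simp]: "\<zero>\<^bsub>UP R\<^esub> n = \<zero>\<^bsub>R\<^esub>"
  by (simp add: UP_def)

lemma UP_one_apply: "\<one>\<^bsub>UP R\<^esub> n = (if n = 0 then \<one>\<^bsub>R\<^esub> else \<zero>\<^bsub>R\<^esub>)"
  by (simp add: UP_def)

lemma UP_add_apply [simp]:
  "p \<in> carrier (UP R) \<Longrightarrow> q \<in> carrier (UP R) \<Longrightarrow> (p \<oplus>\<^bsub>UP R\<^esub> q) n = p n \<oplus>\<^bsub>R\<^esub> q n"
  by (simp add: UP_def)

lemma UP_mult_apply:
  "p \<in> carrier (UP R) \<Longrightarrow> q \<in> carrier (UP R) \<Longrightarrow>
    (p \<otimes>\<^bsub>UP R\<^esub> q) n = (\<Oplus>\<^bsub>R\<^esub>i \<in> {..n}. p i \<otimes>\<^bsub>R\<^esub> q (n - i))"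
  by (simp add: UP_def)

lemma UP_monom_apply: "a \<in> carrier R \<Longrightarrow> monom (UP R) a k n = (if n = k then a else \<zero>\<^bsub>R\<^esub>)"
  by (simp add: UP_def)

lemma UP_monom_closed: "cring R \<Longrightarrow> a \<in> carrier R \<Longrightarrow> monom (UP R) a k \<in> carrier (UP R)"
  by (intro UP_ring.monom_closed) (simp_all add: UP_ring_def cring.axioms)

definition cst :: "('a, 'm) ring_scheme \<Rightarrow> 'a \<Rightarrow> nat \<Rightarrow> 'a"
  where "cst R a = monom (UP R) a 0"

text \<open>The map R[T] -> S[T] induced by h. If h is itself an evaluation of A[X], this
  specialises the inner variable, which makes \<open>at_inner\<close> an instance of base
  change.\<close>

definition pmap :: "('a \<Rightarrow> 'b) \<Rightarrow> (nat \<Rightarrow> 'a) \<Rightarrow> nat \<Rightarrow> 'b"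
  where "pmap h p = (\<lambda>n. h (p n))"

text \<open>$p(T) \mapsto p^h(s\,T)$\<close>

definition dil :: "('b, 'n) ring_scheme \<Rightarrow> ('a \<Rightarrow> 'b) \<Rightarrow> 'b \<Rightarrow> (nat \<Rightarrow> 'a) \<Rightarrow> nat \<Rightarrow> 'b"
  where "dil S h s p = (\<lambda>n. h (p n) \<otimes>\<^bsub>S\<^esub> s [^]\<^bsub>S\<^esub> n)"

lemma cst_hom: "cring R \<Longrightarrow> cst R \<in> ring_hom R (UP R)"
  using UP_ring.const_ring_hom[of R]
  by (simp add: cst_def[abs_def] UP_ring_def cring.axioms)

text \<open>The substitution T -> s T acts on each coefficient separately, so multiplicativity can
  be read off the convolution, where s^n splits as s^i s^(n-i).\<close>

lemma (in ring_hom_cring) dil_hom: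
  assumes s: "s \<in> carrier S"
  shows "dil S h s \<in> ring_hom (UP R) (UP S)"
proof -
  interpret PR: cring "UP R" by (rule cring_UP) (rule R.cring_axioms)
  interpret PS: cring "UP S" by (rule cring_UP) (rule S.cring_axioms)
  have cl: "dil S h s p \<in> carrier (UP S)" if "p \<in> carrier (UP R)" for p
    using that s by (fastforce simp: mem_UP dil_def)
  show ?thesis
  proof (rule ring_hom_memI)
    fix p assume p: "p \<in> carrier (UP R)" then show "dil S h s p \<in> carrier (UP S)" by (rule cl)
    fix q assume q: "q \<in> carrier (UP R)"
    show "dil S h s (p \<oplus>\<^bsub>UP R\<^esub> q) = dil S h s p \<oplus>\<^bsub>UP S\<^esub> dil S h s q"
      using p q s cl[OF p] cl[OF q] by (simp add: dil_def S.l_distr UP_coeff_closed[OF p] UP_coeff_closed[OF q] fun_eq_iff)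
    show "dil S h s (p \<otimes>\<^bsub>UP R\<^esub> q) = dil S h s p \<otimes>\<^bsub>UP S\<^esub> dil S h s q"
    proof
      fix n
      have "dil S h s (p \<otimes>\<^bsub>UP R\<^esub> q) n
          = (\<Oplus>\<^bsub>S\<^esub>i \<in> {..n}. h (p i) \<otimes>\<^bsub>S\<^esub> h (q (n - i))) \<otimes>\<^bsub>S\<^esub> s [^]\<^bsub>S\<^esub> n"
        using p q by (simp add: dil_def UP_mult_apply Pi_def comp_def UP_coeff_closed[OF p] UP_coeff_closed[OF q])
      also have "\<dots> = (\<Oplus>\<^bsub>S\<^esub>i \<in> {..n}. h (p i) \<otimes>\<^bsub>S\<^esub> h (q (n - i)) \<otimes>\<^bsub>S\<^esub> s [^]\<^bsub>S\<^esub> n)"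
        using p q s by (intro S.finsum_ldistr) (simp_all add: Pi_def UP_coeff_closed[OF p] UP_coeff_closed[OF q])
      also have "\<dots> = (\<Oplus>\<^bsub>S\<^esub>i \<in> {..n}. dil S h s p i \<otimes>\<^bsub>S\<^esub> dil S h s q (n - i))"
      proof (rule S.finsum_cong')
        fix i assume "i \<in> {..n}"
        then have "s [^]\<^bsub>S\<^esub> n = s [^]\<^bsub>S\<^esub> i \<otimes>\<^bsub>S\<^esub> s [^]\<^bsub>S\<^esub> (n - i)"
          using s by (simp add: S.nat_pow_mult)
        then show "h (p i) \<otimes>\<^bsub>S\<^esub> h (q (n - i)) \<otimes>\<^bsub>S\<^esub> s [^]\<^bsub>S\<^esub> n = dil S h s p i \<otimes>\<^bsub>S\<^esub> dil S h s q (n - i)"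
          using p q s by (simp add: dil_def S.m_ac UP_coeff_closed[OF p] UP_coeff_closed[OF q])
      qed (use p q s in \<open>simp_all add: dil_def Pi_def UP_coeff_closed[OF p] UP_coeff_closed[OF q]\<close>)
      finally show "dil S h s (p \<otimes>\<^bsub>UP R\<^esub> q) n = (dil S h s p \<otimes>\<^bsub>UP S\<^esub> dil S h s q) n"
        by (simp only: UP_mult_apply[OF cl[OF p] cl[OF q]])
    qed
  next
    show "dil S h s \<one>\<^bsub>UP R\<^esub> = \<one>\<^bsub>UP S\<^esub>" using s by (auto simp: dil_def UP_one_apply)
  qed
qed

lemma (in ring_hom_cring) dil_one: "p \<in> carrier (UP R) \<Longrightarrow> dil S h \<one>\<^bsub>S\<^esub> p = pmap h p"
  by (simp add: dil_def pmap_def UP_coeff_closed[of p R])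

text \<open>Base change is the dilation by 1, so the convolution argument is not repeated.\<close>

lemma pmap_hom:
  assumes "h \<in> ring_hom R S" "cring R" "cring S"
  shows "pmap h \<in> ring_hom (UP R) (UP S)"
proof -
  interpret ring_hom_cring R S h using assms by (intro ring_hom_cringI)
  show ?thesis
    by (rule ring_hom_cong[OF dil_hom[OF S.one_closed] cring.axioms(1)[OF cring_UP[OF assms(2)]]])
      (rule dil_one)
qed

lemma pmap_monom:
  assumes "h \<in> ring_hom R S" "cring R" "cring S" "a \<in> carrier R"
  shows "pmap h (monom (UP R) a k) = monom (UP S) (h a) k"
  using assms ring_hom_zero[OF assms(1)] by (simp add: pmap_def UP_monom_apply ring_hom_closed cring.axioms fun_eq_iff)

lemma eval_hom:
  assumes "cring R" "r \<in> carrier R"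
  shows "eval R R id r \<in> ring_hom (UP R) R"
proof -
  interpret UP_pre_univ_prop R R id "UP R"
    using assms by (intro UP_pre_univ_propI) (auto intro: ring_hom_memI)
  show ?thesis by (rule eval_ring_hom) fact
qed

lemma eval_monom_id:
  assumes "cring R" "r \<in> carrier R" "a \<in> carrier R"
  shows "eval R R id r (monom (UP R) a k) = a \<otimes>\<^bsub>R\<^esub> r [^]\<^bsub>R\<^esub> k"
proof -
  interpret UP_pre_univ_prop R R id "UP R"
    using assms by (intro UP_pre_univ_propI) (auto intro: ring_hom_memI)
  show ?thesis using assms by (simp add: eval_monom)
qed

text \<open>The uniqueness half of the universal property of R[T]: both maps are the evaluation at
  the common image of T, extending the same map on constants.\<close>

lemma UP_hom_eqI:
  assumes "cring R" "cring S" "\<phi> \<in> ring_hom (UP R) S" "\<psi> \<in> ring_hom (UP R) S"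
    and c: "\<And>a. a \<in> carrier R \<Longrightarrow> \<phi> (monom (UP R) a 0) = \<psi> (monom (UP R) a 0)"
    and X: "\<phi> (monom (UP R) \<one>\<^bsub>R\<^esub> 1) = \<psi> (monom (UP R) \<one>\<^bsub>R\<^esub> 1)"
    and p: "p \<in> carrier (UP R)"
  shows "\<phi> p = \<psi> p"
proof -
  interpret R: cring R by fact
  have h: "\<phi> \<circ> cst R \<in> ring_hom R S"
    by (rule ring_hom_trans[OF cst_hom]) fact+
  interpret UP_pre_univ_prop R S "\<phi> \<circ> cst R" "UP R"
    using assms h by (intro UP_pre_univ_propI)
  have cr: "cring (UP R)" by (rule cring_UP) fact
  show ?thesis
    by (rule UP_hom_unique[where s = "\<phi> (monom (UP R) \<one>\<^bsub>R\<^esub> 1)"])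
      (use assms(1,2,3,4) c X[symmetric] p cr in
        \<open>simp_all add: cst_def ring_hom_cringI ring_hom_closed[OF assms(3)] UP_monom_closed\<close>)
qed

text \<open>Naturality of evaluation, checked on monomials. With h itself an evaluation it lets the
  two variables of a nested polynomial be specialised in either order.\<close>

lemma eval_pmap:
  assumes "h \<in> ring_hom R S" "cring R" "cring S" "r \<in> carrier R" "p \<in> carrier (UP R)"
  shows "eval S S id (h r) (pmap h p) = h (eval R R id r p)"
proof -
  interpret ring_hom_cring R S h using assms by (intro ring_hom_cringI)
  have "(eval S S id (h r) \<circ> pmap h) p = (h \<circ> eval R R id r) p"
  proof (rule UP_hom_eqI[OF assms(2,3) _ _ _ _ assms(5)])
    show "eval S S id (h r) \<circ> pmap h \<in> ring_hom (UP R) S"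
      by (rule ring_hom_trans[OF pmap_hom eval_hom]) (use assms in simp_all)
    show "h \<circ> eval R R id r \<in> ring_hom (UP R) S"
      by (rule ring_hom_trans[OF eval_hom]) (use assms in simp_all)
    fix a assume a: "a \<in> carrier R"
    have "(eval S S id (h r) \<circ> pmap h) (monom (UP R) a k) = (h \<circ> eval R R id r) (monom (UP R) a k)" for k
      unfolding o_apply pmap_monom[OF assms(1-3) a] eval_monom_id[OF assms(2,4) a]
      by (subst eval_monom_id) (use assms a in simp_all)
    from this[of 0] show "(eval S S id (h r) \<circ> pmap h) (monom (UP R) a 0) = (h \<circ> eval R R id r) (monom (UP R) a 0)" .
  next
    show "(eval S S id (h r) \<circ> pmap h) (monom (UP R) \<one>\<^bsub>R\<^esub> 1) = (h \<circ> eval R R id r) (monom (UP R) \<one>\<^bsub>R\<^esub> 1)"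
      unfolding o_apply pmap_monom[OF assms(1-3) R.one_closed] eval_monom_id[OF assms(2,4) R.one_closed]
      by (subst eval_monom_id) (use assms in simp_all)
  qed
  then show ?thesis by simp
qed

text \<open>Taking the constant coefficient is a ring homomorphism because the convolution in degree
  0 has a single term, and it agrees with evaluation at 0 on constants and on T.\<close>

lemma eval_zero:
  assumes "cring R" "p \<in> carrier (UP R)"
  shows "eval R R id \<zero>\<^bsub>R\<^esub> p = p 0"
proof -
  interpret cring R by fact
  have "(\<lambda>p. p 0) \<in> ring_hom (UP R) R"
  proof (rule ring_hom_memI)
    fix p assume p: "p \<in> carrier (UP R)"
    then show "p 0 \<in> carrier R" by (rule UP_coeff_closed)
    fix q assume q: "q \<in> carrier (UP R)"
    show "(p \<otimes>\<^bsub>UP R\<^esub> q) 0 = p 0 \<otimes>\<^bsub>R\<^esub> q 0"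
      using UP_coeff_closed[OF p, of 0] UP_coeff_closed[OF q, of 0] by (simp add: UP_mult_apply p q)
  qed (simp_all add: UP_one_apply)
  then show ?thesis
    by (rule UP_hom_eqI[OF assms(1,1) eval_hom[OF assms(1) zero_closed] _ _ _ assms(2)])
      (simp_all add: eval_monom_id UP_monom_apply is_cring)
qed

lemma eval_dil_zero:
  assumes h: "h \<in> ring_hom R S" and R: "cring R" and S: "cring S" and s: "s \<in> carrier S"
    and p: "p \<in> carrier (UP R)"
  shows "eval S S id \<zero>\<^bsub>S\<^esub> (dil S h s p) = h (eval R R id \<zero>\<^bsub>R\<^esub> p)"
proof -
  interpret ring_hom_cring R S h using R S h by (rule ring_hom_cringI)
  have "p 0 \<in> carrier R" using p by (rule UP_coeff_closed)
  then have "dil S h s p 0 = h (p 0)" by (simp add: dil_def)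
  then show ?thesis
    by (simp only: eval_zero[OF R p] eval_zero[OF S ring_hom_closed[OF dil_hom[OF s] p]])
qed

text \<open>The commuting square g h = k l is kept general because it has two uses: with k and l the
  identity when a glued matrix is restricted to an end, and with k a second embedding of constants
  when a glued matrix is shown to stay trivial.\<close>

lemma pmap_dil:
  assumes g: "g \<in> ring_hom S S'" and h: "h \<in> ring_hom R S" and "cring S" "cring S'" and s: "s \<in> carrier S"
    and k: "\<And>a. a \<in> carrier R \<Longrightarrow> g (h a) = k (l a)" and p: "p \<in> carrier (UP R)"
  shows "pmap g (dil S h s p) = dil S' k (g s) (pmap l p)"
proof
  fix n
  interpret ring_hom_cring S S' g using assms by (intro ring_hom_cringI)
  have pn: "p n \<in> carrier R" using p by (rule UP_coeff_closed)
  have "h (p n) \<in> carrier S" by (rule ring_hom_closed[OF h pn])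
  then show "pmap g (dil S h s p) n = dil S' k (g s) (pmap l p) n"
    using s by (simp add: pmap_def dil_def k[OF pn])
qed
text \<open>Since 0^0 = 1, the constant coefficient survives dilation by 0 and all others
  vanish.\<close>

lemma dil_zero:
  assumes "cring R" "p \<in> carrier (UP R)"
  shows "dil R id \<zero>\<^bsub>R\<^esub> p = cst R (eval R R id \<zero>\<^bsub>R\<^esub> p)"
proof
  interpret cring R by fact
  fix n show "dil R id \<zero>\<^bsub>R\<^esub> p n = cst R (eval R R id \<zero>\<^bsub>R\<^esub> p) n"
    unfolding dil_def eval_zero[OF assms] cst_def UP_monom_apply[OF UP_coeff_closed[OF assms(2)]]
    using UP_coeff_closed[OF assms(2)] by (cases "n = 0") (simp_all add: nat_pow_zero)
qed

text \<open>\<open>subst2\<close> performs the substitution T -> s T as an evaluation at the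
  monomial s T. Both sides are homomorphisms that agree on generators, so M can be handled
  coefficientwise.\<close>

lemma eval_eq_dil:
  assumes "h \<in> ring_hom R S" "cring R" "cring S" "s \<in> carrier S" "p \<in> carrier (UP R)"
  shows "eval R (UP S) (\<lambda>a. monom (UP S) (h a) 0) (monom (UP S) s 1) p = dil S h s p"
proof -
  interpret ring_hom_cring R S h using assms by (intro ring_hom_cringI)
  have ch: "(\<lambda>a. monom (UP S) (h a) 0) \<in> ring_hom R (UP S)"
    using ring_hom_trans[OF homh cst_hom] assms by (simp add: cst_def[abs_def] comp_def)
  interpret U: UP_pre_univ_prop R "UP S" "\<lambda>a. monom (UP S) (h a) 0" "UP R"
    using assms ch by (intro UP_pre_univ_propI) (auto intro: cring_UP)
  have m: "monom (UP S) s 1 \<in> carrier (UP S)" by (rule UP_monom_closed) fact+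
  show ?thesis
  proof (rule UP_hom_eqI[of R "UP S" "eval R (UP S) (\<lambda>a. monom (UP S) (h a) 0) (monom (UP S) s 1)" "dil S h s"])
    fix a assume "a \<in> carrier R"
    then show "eval R (UP S) (\<lambda>a. monom (UP S) (h a) 0) (monom (UP S) s 1) (monom (UP R) a 0) = dil S h s (monom (UP R) a 0)"
      using assms(4) by (subst U.eval_const[OF m]) (simp_all add: dil_def UP_monom_apply fun_eq_iff)
  next
    show "eval R (UP S) (\<lambda>a. monom (UP S) (h a) 0) (monom (UP S) s 1) (monom (UP R) \<one>\<^bsub>R\<^esub> 1) = dil S h s (monom (UP R) \<one>\<^bsub>R\<^esub> 1)"
      using assms(4) by (subst U.eval_monom1[OF m]) (simp_all add: dil_def UP_monom_apply fun_eq_iff)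
  qed (use assms m in \<open>simp_all add: cring_UP U.eval_ring_hom dil_hom\<close>)
qed

section \<open>Matrices over polynomial rings\<close>

lemma at_outer_hom: "cring R \<Longrightarrow> r \<in> carrier R \<Longrightarrow> group_hom (SL2 (UP R)) (SL2 R) (at_outer R r)"
  unfolding at_outer_def by (intro map_SL2_hom cring_UP eval_hom)

lemma at_inner_pmap: "at_inner R r = map_mat2 (pmap (eval R R id r))"
  by (simp add: at_inner_def pmap_def[abs_def])

lemma pmap_SL2_hom:
  "cring R \<Longrightarrow> cring S \<Longrightarrow> h \<in> ring_hom R S \<Longrightarrow> group_hom (SL2 (UP R)) (SL2 (UP S)) (map_mat2 (pmap h))"
  by (intro map_SL2_hom cring_UP pmap_hom)

lemma at_inner_hom:
  "cring R \<Longrightarrow> r \<in> carrier R \<Longrightarrow> group_hom (SL2 (UP (UP R))) (SL2 (UP R)) (at_inner R r)"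
  unfolding at_inner_pmap by (intro pmap_SL2_hom cring_UP eval_hom)

lemma dil_SL2_hom:
  "cring R \<Longrightarrow> cring S \<Longrightarrow> h \<in> ring_hom R S \<Longrightarrow> s \<in> carrier S \<Longrightarrow>
    group_hom (SL2 (UP R)) (SL2 (UP S)) (map_mat2 (dil S h s))"
  by (intro map_SL2_hom cring_UP ring_hom_cring.dil_hom ring_hom_cringI)

lemma cst_SL2_hom: "cring R \<Longrightarrow> group_hom (SL2 R) (SL2 (UP R)) (map_mat2 (cst R))"
  by (intro map_SL2_hom cring_UP cst_hom)

lemma at_outer_pmap:
  assumes "g \<in> ring_hom R S" "cring R" "cring S" "r \<in> carrier R" "x \<in> carrier (SL2 (UP R))"
  shows "at_outer S (g r) (map_mat2 (pmap g) x) = map_mat2 g (at_outer R r x)"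
  unfolding at_outer_def mat2.map_comp
  by (rule map_mat2_SL2_cong[OF assms(5)]) (simp add: eval_pmap[OF assms(1-4)])

lemma at_outer_cst:
  assumes "cring R" "r \<in> carrier R" "x \<in> carrier (SL2 R)"
  shows "at_outer R r (map_mat2 (cst R) x) = x"
proof -
  interpret cring R by fact
  show ?thesis
    unfolding at_outer_def mat2.map_comp
    by (rule map_mat2_SL2_ident[OF assms(3)]) (simp add: cst_def eval_monom_id assms)
qed

text \<open>Constants split every evaluation. Surjectivity is what carries normality of a kernel
  over to its image.\<close>

lemma at_outer_surj:
  assumes "cring R" "r \<in> carrier R"
  shows "at_outer R r ` carrier (SL2 (UP R)) = carrier (SL2 R)"
proof (intro equalityI subsetI)
  interpret o: group_hom "SL2 (UP R)" "SL2 R" "at_outer R r" by (rule at_outer_hom[OF assms])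
  interpret c: group_hom "SL2 R" "SL2 (UP R)" "map_mat2 (cst R)" by (rule cst_SL2_hom[OF assms(1)])
  fix x
  show "x \<in> at_outer R r ` carrier (SL2 (UP R)) \<Longrightarrow> x \<in> carrier (SL2 R)" by auto
  assume x: "x \<in> carrier (SL2 R)"
  show "x \<in> at_outer R r ` carrier (SL2 (UP R))"
    using at_outer_cst[OF assms x, symmetric] c.hom_closed[OF x] by (rule image_eqI)
qed

lemma pmap_cst:
  assumes "g \<in> ring_hom R S" "cring R" "cring S" "x \<in> carrier (SL2 R)"
  shows "map_mat2 (pmap g) (map_mat2 (cst R) x) = map_mat2 (cst S) (map_mat2 g x)"
  unfolding mat2.map_comp
  by (rule map_mat2_SL2_cong[OF assms(4)]) (simp add: cst_def pmap_monom[OF assms(1-3)])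

lemma at_outer_dil_zero:
  assumes "h \<in> ring_hom R S" "cring R" "cring S" "s \<in> carrier S" "x \<in> carrier (SL2 (UP R))"
  shows "at_outer S \<zero>\<^bsub>S\<^esub> (map_mat2 (dil S h s) x) = map_mat2 h (at_outer R \<zero>\<^bsub>R\<^esub> x)"
  unfolding at_outer_def mat2.map_comp
  by (rule map_mat2_SL2_cong[OF assms(5)]) (simp add: eval_dil_zero[OF assms(1-4)])

lemma pmap_SL2_dil:
  assumes "g \<in> ring_hom S S'" "h \<in> ring_hom R S" "cring S" "cring S'" "s \<in> carrier S"
    and "\<And>a. a \<in> carrier R \<Longrightarrow> g (h a) = k (l a)" "x \<in> carrier (SL2 (UP R))"
  shows "map_mat2 (pmap g) (map_mat2 (dil S h s) x) = map_mat2 (dil S' k (g s)) (map_mat2 (pmap l) x)"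
  unfolding mat2.map_comp
  by (rule map_mat2_SL2_cong[OF assms(7)]) (simp add: pmap_dil[OF assms(1-5), where k = k and l = l] assms(6))

lemma pmap_ident: "map_mat2 (pmap (\<lambda>a. a)) x = x"
  by (simp add: pmap_def[abs_def] mat2.map_ident)

lemma ident_hom: "(\<lambda>a. a) \<in> ring_hom R R"
  by (rule ring_hom_memI) simp_all

lemma dil_SL2_one:
  assumes "cring R" "x \<in> carrier (SL2 (UP R))"
  shows "map_mat2 (dil R (\<lambda>a. a) \<one>\<^bsub>R\<^esub>) x = x"
proof (rule map_mat2_SL2_ident[OF assms(2)])
  fix p assume "p \<in> carrier (UP R)"
  from ring_hom_cring.dil_one[OF ring_hom_cringI[OF assms(1,1) ident_hom] this]
  show "dil R (\<lambda>a. a) \<one>\<^bsub>R\<^esub> p = p" by (simp add: pmap_def)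
qed

lemma dil_SL2_zero:
  assumes "cring R" "x \<in> carrier (SL2 (UP R))"
  shows "map_mat2 (dil R (\<lambda>a. a) \<zero>\<^bsub>R\<^esub>) x = map_mat2 (cst R) (at_outer R \<zero>\<^bsub>R\<^esub> x)"
  unfolding at_outer_def mat2.map_comp
  by (rule map_mat2_SL2_cong[OF assms(2)]) (simp add: dil_zero[OF assms(1), unfolded id_def] id_def)

text \<open>Once the outer variable is specialised, the inner one takes its place, so
  \<open>at_outer R r\<close> on the left and \<open>at_inner R r\<close> on the right act on the
  same variable. The exchange is naturality along evaluation at r, which sends 0 and 1 to 0 and
  1.\<close>

lemma at_outer_at_outer:
  assumes R: "cring R" and r: "r \<in> carrier R" and x: "x \<in> carrier (SL2 (UP (UP R)))"
  shows "at_outer R r (at_outer (UP R) \<zero>\<^bsub>UP R\<^esub> x) = at_outer R \<zero>\<^bsub>R\<^esub> (at_inner R r x)"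
    and "at_outer R r (at_outer (UP R) \<one>\<^bsub>UP R\<^esub> x) = at_outer R \<one>\<^bsub>R\<^esub> (at_inner R r x)"
proof -
  interpret ring_hom_cring "UP R" R "eval R R id r"
    by (rule ring_hom_cringI[OF cring_UP[OF R] R eval_hom[OF R r]])
  show "at_outer R r (at_outer (UP R) \<zero>\<^bsub>UP R\<^esub> x) = at_outer R \<zero>\<^bsub>R\<^esub> (at_inner R r x)"
    "at_outer R r (at_outer (UP R) \<one>\<^bsub>UP R\<^esub> x) = at_outer R \<one>\<^bsub>R\<^esub> (at_inner R r x)"
    using at_outer_pmap[OF homh cring_UP[OF R] R R.zero_closed x] at_outer_pmap[OF homh cring_UP[OF R] R R.one_closed x]
    by (simp_all add: at_inner_pmap at_outer_def[of R r])
qed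

lemma at_inner_cst:
  assumes R: "cring R" and r: "r \<in> carrier R" and x: "x \<in> carrier (SL2 (UP R))"
  shows "at_inner R r (map_mat2 (cst (UP R)) x) = map_mat2 (cst R) (at_outer R r x)"
  unfolding at_inner_pmap at_outer_def
  by (rule pmap_cst[OF eval_hom[OF R r] cring_UP[OF R] R x])

lemma at_outer_pmap01:
  assumes "g \<in> ring_hom R S" "cring R" "cring S" "x \<in> carrier (SL2 (UP R))"
  shows "at_outer S \<zero>\<^bsub>S\<^esub> (map_mat2 (pmap g) x) = map_mat2 g (at_outer R \<zero>\<^bsub>R\<^esub> x)"
    and "at_outer S \<one>\<^bsub>S\<^esub> (map_mat2 (pmap g) x) = map_mat2 g (at_outer R \<one>\<^bsub>R\<^esub> x)"
proof -
  interpret ring_hom_cring R S g by (rule ring_hom_cringI[OF assms(2,3,1)])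
  show "at_outer S \<zero>\<^bsub>S\<^esub> (map_mat2 (pmap g) x) = map_mat2 g (at_outer R \<zero>\<^bsub>R\<^esub> x)"
    "at_outer S \<one>\<^bsub>S\<^esub> (map_mat2 (pmap g) x) = map_mat2 g (at_outer R \<one>\<^bsub>R\<^esub> x)"
    using at_outer_pmap[OF assms(1-3) R.zero_closed assms(4)] at_outer_pmap[OF assms(1-3) R.one_closed assms(4)]
    by simp_all
qed

section \<open>Classes as cosets of normal subgroups\<close>

lemma (in normal) rcos_eq_iff:
  assumes "x \<in> carrier G" "y \<in> carrier G"
  shows "H #> x = H #> y \<longleftrightarrow> x \<otimes> inv y \<in> H"
proof
  assume "H #> x = H #> y"
  then have "x \<in> H #> y" using rcos_self[OF assms(1) subgroup_axioms] by simp
  then obtain h where "h \<in> H" "x = h \<otimes> y" by (auto simp: r_coset_def)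
  then show "x \<otimes> inv y \<in> H" using assms by (simp add: m_assoc)
next
  assume h: "x \<otimes> inv y \<in> H"
  have "x = (x \<otimes> inv y) \<otimes> y" using assms by (simp add: m_assoc)
  then have "x \<in> H #> y" using h by (auto simp: r_coset_def)
  then show "H #> x = H #> y" using repr_independence[OF _ assms(2) subgroup_axioms] by simp
qed

lemma (in normal) rcos_mult_cong:
  assumes "x \<in> carrier G" "y \<in> carrier G" "x' \<in> carrier G" "y' \<in> carrier G"
    and "H #> x = H #> x'" "H #> y = H #> y'"
  shows "H #> (x \<otimes> y) = H #> (x' \<otimes> y')"
  using assms by (simp flip: rcos_sum)

lemma (in normal) rcos_inv_cong:
  assumes "x \<in> carrier G" "x' \<in> carrier G" "H #> x = H #> x'"
  shows "H #> inv x = H #> inv x'"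
  using assms by (simp flip: rcos_inv)

lemma rcos_hom_cong:
  assumes "group_hom G G' f" "N \<lhd> G" "N' \<lhd> G'" "f ` N \<subseteq> N'" "x \<in> carrier G" "y \<in> carrier G"
    and "N #>\<^bsub>G\<^esub> x = N #>\<^bsub>G\<^esub> y"
  shows "N' #>\<^bsub>G'\<^esub> f x = N' #>\<^bsub>G'\<^esub> f y"
proof -
  interpret group_hom G G' f by fact
  have "f (x \<otimes>\<^bsub>G\<^esub> inv\<^bsub>G\<^esub> y) \<in> N'"
    using assms normal.rcos_eq_iff[OF assms(2,5,6)] by blast
  then show ?thesis using assms by (simp add: normal.rcos_eq_iff)
qed

text \<open>Paths that start at the identity form the kernel of evaluation at 0. As the image of a
  normal subgroup under the surjective evaluation at 1, \<open>QL2 R\<close> is itself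
  normal.\<close>

lemma QL2_image: "QL2 R = at_outer R \<one>\<^bsub>R\<^esub> ` kernel (SL2 (UP R)) (SL2 R) (at_outer R \<zero>\<^bsub>R\<^esub>)"
  if "cring R"
proof -
  interpret cring R by fact
  interpret o1: group_hom "SL2 (UP R)" "SL2 R" "at_outer R \<one>\<^bsub>R\<^esub>" by (rule at_outer_hom) (simp_all add: that)
  show ?thesis by (auto simp: QL2_def kernel_def)
qed

lemma normal_QL2: "QL2 R \<lhd> SL2 R" if "cring R"
proof -
  interpret cring R by fact
  interpret o0: group_hom "SL2 (UP R)" "SL2 R" "at_outer R \<zero>\<^bsub>R\<^esub>" by (rule at_outer_hom) (simp_all add: that)
  interpret o1: group_hom "SL2 (UP R)" "SL2 R" "at_outer R \<one>\<^bsub>R\<^esub>" by (rule at_outer_hom) (simp_all add: that)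
  show ?thesis
    unfolding QL2_image[OF that]
    by (rule normal.surj_hom_normal_subgroup[OF o0.normal_kernel o1.group_hom_axioms
          at_outer_surj[OF that one_closed]])
qed

text \<open>The loops homotopic to the trivial one. Each of the three conditions on the homotopy
  defines a kernel, so normality holds in all of SL_2(R[T]) and not only among the loops.\<close>

definition null_loops :: "('a, 'm) ring_scheme \<Rightarrow> (nat \<Rightarrow> 'a) mat2 set" where
  "null_loops R = at_outer (UP R) \<one>\<^bsub>UP R\<^esub> ` {\<gamma> \<in> carrier (SL2 (UP (UP R))).
     at_outer (UP R) \<zero>\<^bsub>UP R\<^esub> \<gamma> = \<one>\<^bsub>SL2 (UP R)\<^esub> \<and>
     at_inner R \<zero>\<^bsub>R\<^esub> \<gamma> = \<one>\<^bsub>SL2 (UP R)\<^esub> \<and> at_inner R \<one>\<^bsub>R\<^esub> \<gamma> = \<one>\<^bsub>SL2 (UP R)\<^esub>}"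

lemma normal_null_loops: "null_loops R \<lhd> SL2 (UP R)" if "cring R"
proof -
  interpret cring R by fact
  have U: "cring (UP R)" by (rule cring_UP) fact
  interpret U: cring "UP R" by fact
  interpret i0: group_hom "SL2 (UP (UP R))" "SL2 (UP R)" "at_inner R \<zero>\<^bsub>R\<^esub>" by (rule at_inner_hom) (simp_all add: that)
  interpret i1: group_hom "SL2 (UP (UP R))" "SL2 (UP R)" "at_inner R \<one>\<^bsub>R\<^esub>" by (rule at_inner_hom) (simp_all add: that)
  interpret o0: group_hom "SL2 (UP (UP R))" "SL2 (UP R)" "at_outer (UP R) \<zero>\<^bsub>UP R\<^esub>" by (rule at_outer_hom) (simp_all add: U)
  interpret o1: group_hom "SL2 (UP (UP R))" "SL2 (UP R)" "at_outer (UP R) \<one>\<^bsub>UP R\<^esub>" by (rule at_outer_hom) (simp_all add: U)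
  have "kernel (SL2 (UP (UP R))) (SL2 (UP R)) (at_outer (UP R) \<zero>\<^bsub>UP R\<^esub>) \<inter>
      (kernel (SL2 (UP (UP R))) (SL2 (UP R)) (at_inner R \<zero>\<^bsub>R\<^esub>) \<inter>
       kernel (SL2 (UP (UP R))) (SL2 (UP R)) (at_inner R \<one>\<^bsub>R\<^esub>)) \<lhd> SL2 (UP (UP R))"
    by (intro i0.G.normal_subgroup_intersect o0.normal_kernel i0.normal_kernel i1.normal_kernel)
  from normal.surj_hom_normal_subgroup[OF this o1.group_hom_axioms at_outer_surj[OF U U.one_closed]]
  show ?thesis
    by (rule back_subst[of "\<lambda>N. N \<lhd> SL2 (UP R)"]) (auto simp: null_loops_def kernel_def intro!: image_eqI[OF refl])
qed

lemma null_loops_subset: "null_loops R \<subseteq> loops R" if "cring R"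
proof
  interpret cring R by fact
  have U: "cring (UP R)" by (rule cring_UP) fact
  interpret U: cring "UP R" by fact
  interpret o0: group_hom "SL2 (UP R)" "SL2 R" "at_outer R \<zero>\<^bsub>R\<^esub>" by (rule at_outer_hom) (simp_all add: that)
  interpret o1: group_hom "SL2 (UP R)" "SL2 R" "at_outer R \<one>\<^bsub>R\<^esub>" by (rule at_outer_hom) (simp_all add: that)
  interpret oo: group_hom "SL2 (UP (UP R))" "SL2 (UP R)" "at_outer (UP R) \<one>\<^bsub>UP R\<^esub>" by (rule at_outer_hom) (simp_all add: U)
  fix x assume "x \<in> null_loops R"
  then show "x \<in> loops R"
    by (auto simp: null_loops_def loops_def at_outer_at_outer that)
qed

lemma loopsD:
  assumes "a \<in> loops R"
  shows "a \<in> carrier (SL2 (UP R))" "at_outer R \<zero>\<^bsub>R\<^esub> a = \<one>\<^bsub>SL2 R\<^esub>" "at_outer R \<one>\<^bsub>R\<^esub> a = \<one>\<^bsub>SL2 R\<^esub>"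
  using assms by (simp_all add: loops_def)

lemma subgroup_loops: "subgroup (loops R) (SL2 (UP R))" if "cring R"
proof -
  interpret cring R by fact
  interpret o0: group_hom "SL2 (UP R)" "SL2 R" "at_outer R \<zero>\<^bsub>R\<^esub>" by (rule at_outer_hom) (simp_all add: that)
  interpret o1: group_hom "SL2 (UP R)" "SL2 R" "at_outer R \<one>\<^bsub>R\<^esub>" by (rule at_outer_hom) (simp_all add: that)
  have "loops R = kernel (SL2 (UP R)) (SL2 R) (at_outer R \<zero>\<^bsub>R\<^esub>) \<inter> kernel (SL2 (UP R)) (SL2 R) (at_outer R \<one>\<^bsub>R\<^esub>)"
    by (auto simp: loops_def kernel_def)
  then show ?thesis
    using o0.G.subgroups_Inter_pair[OF o0.subgroup_kernel o1.subgroup_kernel] by simp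
qed

text \<open>A homotopy from a to b, times the inverse of the constant homotopy at a, is a
  null-homotopy of b a^-1; multiplying a null-homotopy by the constant homotopy reverses this. Here
  \<open>c\<close> is that constant homotopy.\<close>

lemma loop_class_rcos: "loop_class R a = null_loops R #>\<^bsub>SL2 (UP R)\<^esub> a"
  if R: "cring R" and a: "a \<in> loops R"
proof -
  interpret cring R by fact
  have U: "cring (UP R)" by (rule cring_UP) fact
  interpret U: cring "UP R" by fact
  interpret i0: group_hom "SL2 (UP (UP R))" "SL2 (UP R)" "at_inner R \<zero>\<^bsub>R\<^esub>" by (rule at_inner_hom) (simp_all add: R)
  interpret i1: group_hom "SL2 (UP (UP R))" "SL2 (UP R)" "at_inner R \<one>\<^bsub>R\<^esub>" by (rule at_inner_hom) (simp_all add: R)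
  interpret o0: group_hom "SL2 (UP (UP R))" "SL2 (UP R)" "at_outer (UP R) \<zero>\<^bsub>UP R\<^esub>" by (rule at_outer_hom) (simp_all add: U)
  interpret o1: group_hom "SL2 (UP (UP R))" "SL2 (UP R)" "at_outer (UP R) \<one>\<^bsub>UP R\<^esub>" by (rule at_outer_hom) (simp_all add: U)
  interpret c: group_hom "SL2 (UP R)" "SL2 (UP (UP R))" "map_mat2 (cst (UP R))" by (rule cst_SL2_hom) fact
  interpret c': group_hom "SL2 R" "SL2 (UP R)" "map_mat2 (cst R)" by (rule cst_SL2_hom) fact
  interpret L: subgroup "loops R" "SL2 (UP R)" by (rule subgroup_loops) fact
  have ac: "a \<in> carrier (SL2 (UP R))" using a by (rule L.mem_carrier)
  define c where "c = map_mat2 (cst (UP R)) a"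
  have c: "c \<in> carrier (SL2 (UP (UP R)))" using ac by (simp add: c_def)
  have co: "at_outer (UP R) \<zero>\<^bsub>UP R\<^esub> c = a" "at_outer (UP R) \<one>\<^bsub>UP R\<^esub> c = a"
    unfolding c_def by (rule at_outer_cst[OF U _ ac]; simp)+
  have ci: "at_inner R \<zero>\<^bsub>R\<^esub> c = \<one>\<^bsub>SL2 (UP R)\<^esub>" "at_inner R \<one>\<^bsub>R\<^esub> c = \<one>\<^bsub>SL2 (UP R)\<^esub>"
    by (simp_all add: c_def at_inner_cst[OF R _ ac] loopsD[OF a])
  show ?thesis
  proof (intro equalityI subsetI)
    fix b assume "b \<in> loop_class R a"
    then obtain g where g: "g \<in> carrier (SL2 (UP (UP R)))" "at_outer (UP R) \<zero>\<^bsub>UP R\<^esub> g = a"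
      "at_outer (UP R) \<one>\<^bsub>UP R\<^esub> g = b" "at_inner R \<zero>\<^bsub>R\<^esub> g = \<one>\<^bsub>SL2 (UP R)\<^esub>"
      "at_inner R \<one>\<^bsub>R\<^esub> g = \<one>\<^bsub>SL2 (UP R)\<^esub>" and b: "b \<in> loops R"
      by (auto simp: loop_class_def loop_rel_def)
    have bc: "b \<in> carrier (SL2 (UP R))" using b by (rule L.mem_carrier)
    have "b \<otimes>\<^bsub>SL2 (UP R)\<^esub> inv\<^bsub>SL2 (UP R)\<^esub> a \<in> null_loops R"
      unfolding null_loops_def
      by (rule image_eqI[of _ _ "g \<otimes>\<^bsub>SL2 (UP (UP R))\<^esub> inv\<^bsub>SL2 (UP (UP R))\<^esub> c"])
        (use g c co ci ac in simp_all)
    moreover have "b = b \<otimes>\<^bsub>SL2 (UP R)\<^esub> inv\<^bsub>SL2 (UP R)\<^esub> a \<otimes>\<^bsub>SL2 (UP R)\<^esub> a"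
      using bc ac by (simp add: i0.H.m_assoc)
    ultimately show "b \<in> null_loops R #>\<^bsub>SL2 (UP R)\<^esub> a" unfolding r_coset_def by blast
  next
    fix b assume "b \<in> null_loops R #>\<^bsub>SL2 (UP R)\<^esub> a"
    then obtain n where n: "n \<in> null_loops R" and b: "b = n \<otimes>\<^bsub>SL2 (UP R)\<^esub> a" by (auto simp: r_coset_def)
    then obtain g where g: "g \<in> carrier (SL2 (UP (UP R)))" "at_outer (UP R) \<zero>\<^bsub>UP R\<^esub> g = \<one>\<^bsub>SL2 (UP R)\<^esub>"
      "at_outer (UP R) \<one>\<^bsub>UP R\<^esub> g = n" "at_inner R \<zero>\<^bsub>R\<^esub> g = \<one>\<^bsub>SL2 (UP R)\<^esub>"
      "at_inner R \<one>\<^bsub>R\<^esub> g = \<one>\<^bsub>SL2 (UP R)\<^esub>" by (auto simp: null_loops_def)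
    have "b \<in> loops R" using n a null_loops_subset[OF R] by (auto simp: b)
    moreover have "\<exists>g \<in> carrier (SL2 (UP (UP R))). at_outer (UP R) \<zero>\<^bsub>UP R\<^esub> g = a \<and> at_outer (UP R) \<one>\<^bsub>UP R\<^esub> g = b \<and>
      at_inner R \<zero>\<^bsub>R\<^esub> g = \<one>\<^bsub>SL2 (UP R)\<^esub> \<and> at_inner R \<one>\<^bsub>R\<^esub> g = \<one>\<^bsub>SL2 (UP R)\<^esub>"
      by (rule bexI[of _ "g \<otimes>\<^bsub>SL2 (UP (UP R))\<^esub> c"]) (use g c co ci ac b in simp_all)
    ultimately show "b \<in> loop_class R a" using a by (simp add: loop_class_def loop_rel_def)
  qed
qed

lemma SL2_UP_comp_cong:
  assumes "x \<in> carrier (SL2 (UP R))" "\<And>a. a \<in> carrier R \<Longrightarrow> f (g a) = f' (g' a)"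
  shows "map_mat2 (pmap f) (map_mat2 (pmap g) x) = map_mat2 (pmap f') (map_mat2 (pmap g') x)"
  unfolding mat2.map_comp
proof (rule map_mat2_SL2_cong[OF assms(1)])
  fix p assume "p \<in> carrier (UP R)"
  from UP_coeff_closed[OF this] show "(pmap f \<circ> pmap g) p = (pmap f' \<circ> pmap g') p"
    by (simp add: pmap_def assms(2))
qed

lemma loops_map:
  assumes g: "g \<in> ring_hom R S" and R: "cring R" and S: "cring S" and x: "x \<in> loops R"
  shows "map_mat2 (pmap g) x \<in> loops S"
proof -
  interpret h: group_hom "SL2 R" "SL2 S" "map_mat2 g" by (rule map_SL2_hom[OF R S g])
  interpret p: group_hom "SL2 (UP R)" "SL2 (UP S)" "map_mat2 (pmap g)" by (rule pmap_SL2_hom[OF R S g])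
  show ?thesis
    using at_outer_pmap01[OF g R S loopsD(1)[OF x]] p.hom_closed[OF loopsD(1)[OF x]]
    unfolding loopsD(2,3)[OF x] by (simp add: loops_def)
qed

lemma QL2_map:
  assumes g: "g \<in> ring_hom R S" and R: "cring R" and S: "cring S"
  shows "map_mat2 g ` QL2 R \<subseteq> QL2 S"
proof -
  interpret h: group_hom "SL2 R" "SL2 S" "map_mat2 g" by (rule map_SL2_hom[OF R S g])
  interpret p: group_hom "SL2 (UP R)" "SL2 (UP S)" "map_mat2 (pmap g)" by (rule pmap_SL2_hom[OF R S g])
  show ?thesis
  proof (intro image_subsetI)
    fix x assume "x \<in> QL2 R"
    then obtain b where b: "x \<in> carrier (SL2 R)" "b \<in> carrier (SL2 (UP R))"
      "at_outer R \<zero>\<^bsub>R\<^esub> b = \<one>\<^bsub>SL2 R\<^esub>" "at_outer R \<one>\<^bsub>R\<^esub> b = x"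
      by (auto simp: QL2_def)
    then show "map_mat2 g x \<in> QL2 S"
      unfolding QL2_def using at_outer_pmap01[OF g R S b(2)]
      by (auto intro!: bexI[of _ "map_mat2 (pmap g) b"])
  qed
qed

lemma null_loops_map:
  assumes g: "g \<in> ring_hom R S" and R: "cring R" and S: "cring S"
  shows "map_mat2 (pmap g) ` null_loops R \<subseteq> null_loops S"
proof -
  note UR = cring_UP[OF R] and US = cring_UP[OF S] and pg = pmap_hom[OF g R S]
  interpret g: ring_hom_cring R S g by (rule ring_hom_cringI[OF R S g])
  interpret p: group_hom "SL2 (UP R)" "SL2 (UP S)" "map_mat2 (pmap g)" by (rule pmap_SL2_hom[OF R S g])
  interpret pp: group_hom "SL2 (UP (UP R))" "SL2 (UP (UP S))" "map_mat2 (pmap (pmap g))"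
    by (rule pmap_SL2_hom[OF UR US pg])
  have inner: "at_inner S (g r) (map_mat2 (pmap (pmap g)) c) = map_mat2 (pmap g) (at_inner R r c)"
    if c: "c \<in> carrier (SL2 (UP (UP R)))" and r: "r \<in> carrier R" for c r
    unfolding at_inner_pmap by (rule SL2_UP_comp_cong[OF c]) (rule eval_pmap[OF g R S r])
  show ?thesis
  proof (intro image_subsetI)
    fix x assume "x \<in> null_loops R"
    then obtain c where c: "c \<in> carrier (SL2 (UP (UP R)))" "at_outer (UP R) \<zero>\<^bsub>UP R\<^esub> c = \<one>\<^bsub>SL2 (UP R)\<^esub>"
      "at_outer (UP R) \<one>\<^bsub>UP R\<^esub> c = x" "at_inner R \<zero>\<^bsub>R\<^esub> c = \<one>\<^bsub>SL2 (UP R)\<^esub>"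
      "at_inner R \<one>\<^bsub>R\<^esub> c = \<one>\<^bsub>SL2 (UP R)\<^esub>" by (auto simp: null_loops_def)
    then show "map_mat2 (pmap g) x \<in> null_loops S"
      unfolding null_loops_def using at_outer_pmap01[OF pg UR US c(1)] inner[OF c(1) g.R.zero_closed] inner[OF c(1) g.R.one_closed]
      by (intro image_eqI[of _ _ "map_mat2 (pmap (pmap g)) c"]) simp_all
  qed
qed

section \<open>Gluing two paths\<close>

text \<open>
  $a(yT)\,b(xT)$, where \<open>h\<close> embeds \<open>R\<close> into \<open>S\<close> as constants. The matrix $M$ of the paper is the case
  $S = R[X]$, $y = 1 - X$, $x = X$; the case $R = A[T]$, $S = A[X][T]$ glues null-homotopies.
\<close>

definition glue :: "('b, 'n) ring_scheme \<Rightarrow> ('a \<Rightarrow> 'b) \<Rightarrow> 'b \<Rightarrow> 'b \<Rightarrow> (nat \<Rightarrow> 'a) mat2 \<Rightarrow> (nat \<Rightarrow> 'a) mat2 \<Rightarrow> (nat \<Rightarrow> 'b) mat2"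
  where "glue S h y x a b = map_mat2 (dil S h y) a \<otimes>\<^bsub>SL2 (UP S)\<^esub> map_mat2 (dil S h x) b"

context
  fixes R :: "('a, 'm) ring_scheme" and S :: "('b, 'n) ring_scheme" and h y x a b
  assumes R: "cring R" and S: "cring S" and h: "h \<in> ring_hom R S"
    and y: "y \<in> carrier S" and x: "x \<in> carrier S"
    and a: "a \<in> carrier (SL2 (UP R))" "at_outer R \<zero>\<^bsub>R\<^esub> a = \<one>\<^bsub>SL2 R\<^esub>"
    and b: "b \<in> carrier (SL2 (UP R))" "at_outer R \<zero>\<^bsub>R\<^esub> b = \<one>\<^bsub>SL2 R\<^esub>"
begin

lemma glue_closed: "glue S h y x a b \<in> carrier (SL2 (UP S))"
proof -
  interpret dy: group_hom "SL2 (UP R)" "SL2 (UP S)" "map_mat2 (dil S h y)" by (rule dil_SL2_hom[OF R S h y])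
  interpret dx: group_hom "SL2 (UP R)" "SL2 (UP S)" "map_mat2 (dil S h x)" by (rule dil_SL2_hom[OF R S h x])
  show ?thesis using a b by (simp add: glue_def)
qed

lemma glue_at_zero: "at_outer S \<zero>\<^bsub>S\<^esub> (glue S h y x a b) = \<one>\<^bsub>SL2 S\<^esub>"
proof -
  interpret S: cring S by fact
  interpret dy: group_hom "SL2 (UP R)" "SL2 (UP S)" "map_mat2 (dil S h y)" by (rule dil_SL2_hom[OF R S h y])
  interpret dx: group_hom "SL2 (UP R)" "SL2 (UP S)" "map_mat2 (dil S h x)" by (rule dil_SL2_hom[OF R S h x])
  interpret o: group_hom "SL2 (UP S)" "SL2 S" "at_outer S \<zero>\<^bsub>S\<^esub>" by (rule at_outer_hom[OF S S.zero_closed])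
  interpret h: group_hom "SL2 R" "SL2 S" "map_mat2 h" by (rule map_SL2_hom[OF R S h])
  show ?thesis
    using a b at_outer_dil_zero[OF h R S y a(1)] at_outer_dil_zero[OF h R S x b(1)] by (simp add: glue_def)
qed

text \<open>Dilation by 1 is the identity, while dilation by 0 collapses a path to the constant
  matrix at its starting point, which is the identity matrix. Hence exactly one factor of the
  product survives at each end.\<close>

lemma glue_restrict:
  assumes e: "e \<in> ring_hom S R" and eh: "\<And>r. r \<in> carrier R \<Longrightarrow> e (h r) = r"
  shows "e y = \<one>\<^bsub>R\<^esub> \<Longrightarrow> e x = \<zero>\<^bsub>R\<^esub> \<Longrightarrow> map_mat2 (pmap e) (glue S h y x a b) = a"
    and "e y = \<zero>\<^bsub>R\<^esub> \<Longrightarrow> e x = \<one>\<^bsub>R\<^esub> \<Longrightarrow> map_mat2 (pmap e) (glue S h y x a b) = b"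
proof -
  interpret dy: group_hom "SL2 (UP R)" "SL2 (UP S)" "map_mat2 (dil S h y)" by (rule dil_SL2_hom[OF R S h y])
  interpret dx: group_hom "SL2 (UP R)" "SL2 (UP S)" "map_mat2 (dil S h x)" by (rule dil_SL2_hom[OF R S h x])
  interpret e: group_hom "SL2 (UP S)" "SL2 (UP R)" "map_mat2 (pmap e)" by (rule pmap_SL2_hom[OF S R e])
  interpret c: group_hom "SL2 R" "SL2 (UP R)" "map_mat2 (cst R)" by (rule cst_SL2_hom[OF R])
  have d: "map_mat2 (pmap e) (map_mat2 (dil S h z) u) = map_mat2 (dil R (\<lambda>r. r) (e z)) u"
    if "z \<in> carrier S" "u \<in> carrier (SL2 (UP R))" for z u
    using pmap_SL2_dil[OF e h S R that(1) _ that(2), of "\<lambda>r. r" "\<lambda>r. r"] by (simp add: eh pmap_ident)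
  show "e y = \<one>\<^bsub>R\<^esub> \<Longrightarrow> e x = \<zero>\<^bsub>R\<^esub> \<Longrightarrow> map_mat2 (pmap e) (glue S h y x a b) = a"
    using a b by (simp add: glue_def d[OF y a(1)] d[OF x b(1)] dil_SL2_one[OF R] dil_SL2_zero[OF R])
  show "e y = \<zero>\<^bsub>R\<^esub> \<Longrightarrow> e x = \<one>\<^bsub>R\<^esub> \<Longrightarrow> map_mat2 (pmap e) (glue S h y x a b) = b"
    using a b by (simp add: glue_def d[OF y a(1)] d[OF x b(1)] dil_SL2_one[OF R] dil_SL2_zero[OF R])
qed

text \<open>A dilation is a homomorphism and so preserves the identity matrix whatever its factor.
  In use, t and t' specialise the loop variable to 0 or 1, where the glued null-homotopies are
  trivial.\<close>

lemma glue_trivial: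
  assumes R': "cring R'" and S': "cring S'" and t: "t \<in> ring_hom S S'" and t': "t' \<in> ring_hom R R'" and h': "h' \<in> ring_hom R' S'"
    and comm: "\<And>r. r \<in> carrier R \<Longrightarrow> t (h r) = h' (t' r)"
    and triv: "map_mat2 (pmap t') a = \<one>\<^bsub>SL2 (UP R')\<^esub>" "map_mat2 (pmap t') b = \<one>\<^bsub>SL2 (UP R')\<^esub>"
  shows "map_mat2 (pmap t) (glue S h y x a b) = \<one>\<^bsub>SL2 (UP S')\<^esub>"
proof -
  interpret dy: group_hom "SL2 (UP R)" "SL2 (UP S)" "map_mat2 (dil S h y)" by (rule dil_SL2_hom[OF R S h y])
  interpret dx: group_hom "SL2 (UP R)" "SL2 (UP S)" "map_mat2 (dil S h x)" by (rule dil_SL2_hom[OF R S h x])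
  interpret t: group_hom "SL2 (UP S)" "SL2 (UP S')" "map_mat2 (pmap t)" by (rule pmap_SL2_hom[OF S S' t])
  interpret ty: group_hom "SL2 (UP R')" "SL2 (UP S')" "map_mat2 (dil S' h' (t y))"
    by (rule dil_SL2_hom[OF R' S' h' ring_hom_closed[OF t y]])
  interpret tx: group_hom "SL2 (UP R')" "SL2 (UP S')" "map_mat2 (dil S' h' (t x))"
    by (rule dil_SL2_hom[OF R' S' h' ring_hom_closed[OF t x]])
  show ?thesis
    using pmap_SL2_dil[OF t h S S' y _ a(1), of h' t'] pmap_SL2_dil[OF t h S S' x _ b(1), of h' t'] a b
    by (simp add: glue_def triv comm)
qed

end

section \<open>Matrices over fibre products of rings\<close>

text \<open>
  \<open>P\<close> is the subring of $R \times S$ of all \<open>(r, s)\<close> with \<open>d r = s\<close> for every \<open>d \<in> D\<close>: the product for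
  \<open>D = {}\<close>, and \<open>B_ring A\<close> if \<open>D\<close> consists of the evaluations at 0 and 1. The pairing \<open>k\<close> and the
  projections are parameters because over \<open>UP P\<close> they act coefficientwise.
\<close>

locale fibre_product =
  fixes P :: "('p, 'k) ring_scheme" and R :: "('a, 'm) ring_scheme" and S :: "('b, 'n) ring_scheme"
    and D k f g
  assumes P: "cring P" and R: "cring R" and S: "cring S"
    and f: "f \<in> ring_hom P R" and g: "g \<in> ring_hom P S" and D: "D \<subseteq> ring_hom R S"
    and compat: "x \<in> carrier P \<Longrightarrow> d \<in> D \<Longrightarrow> d (f x) = g x"
    and joint_inj: "x \<in> carrier P \<Longrightarrow> y \<in> carrier P \<Longrightarrow> f x = f y \<Longrightarrow> g x = g y \<Longrightarrow> x = y"
    and pair: "r \<in> carrier R \<Longrightarrow> s \<in> carrier S \<Longrightarrow> (\<And>d. d \<in> D \<Longrightarrow> d r = s) \<Longrightarrow>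
      k r s \<in> carrier P \<and> f (k r s) = r \<and> g (k r s) = s"
begin

sublocale f: ring_hom_cring P R f by (rule ring_hom_cringI[OF P R f])
sublocale g: ring_hom_cring P S g by (rule ring_hom_cringI[OF P S g])
sublocale F: group_hom "SL2 P" "SL2 R" "map_mat2 f" by (rule map_SL2_hom[OF P R f])
sublocale G: group_hom "SL2 P" "SL2 S" "map_mat2 g" by (rule map_SL2_hom[OF P S g])

lemma SL2_joint_inj:
  "x \<in> carrier (SL2 P) \<Longrightarrow> y \<in> carrier (SL2 P) \<Longrightarrow> map_mat2 f x = map_mat2 f y \<Longrightarrow>
    map_mat2 g x = map_mat2 g y \<Longrightarrow> x = y"
  by (cases x; cases y) (auto intro: joint_inj)

lemma SL2_compat:
  assumes "x \<in> carrier (SL2 P)" "d \<in> D"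
  shows "map_mat2 d (map_mat2 f x) = map_mat2 g x"
  unfolding mat2.map_comp by (rule map_mat2_SL2_cong[OF assms(1)]) (simp add: compat[OF _ assms(2)])

lemma SL2_pair:
  assumes u: "u \<in> carrier (SL2 R)" and v: "v \<in> carrier (SL2 S)" and d: "\<And>d. d \<in> D \<Longrightarrow> map_mat2 d u = v"
  shows "zip_mat2 k u v \<in> carrier (SL2 P)" "map_mat2 f (zip_mat2 k u v) = u" "map_mat2 g (zip_mat2 k u v) = v"
proof -
  obtain a b c e a' b' c' e' where uv: "u = Mat2 a b c e" "v = Mat2 a' b' c' e'" by (cases u; cases v)
  have k: "k r s \<in> carrier P" "f (k r s) = r" "g (k r s) = s"
    if "(r, s) \<in> {(a, a'), (b, b'), (c, c'), (e, e')}" for r s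
    using that pair[of r s] u v d by (auto simp: uv)
  \<comment> \<open>Both projections of the determinant are 1, and the projections are jointly
    injective.\<close>
  have det: "k a a' \<otimes>\<^bsub>P\<^esub> k e e' \<ominus>\<^bsub>P\<^esub> k b b' \<otimes>\<^bsub>P\<^esub> k c c' = \<one>\<^bsub>P\<^esub>"
    by (rule joint_inj) (use k u v in \<open>auto simp: uv a_minus_def\<close>)
  show "zip_mat2 k u v \<in> carrier (SL2 P)" "map_mat2 f (zip_mat2 k u v) = u" "map_mat2 g (zip_mat2 k u v) = v"
    using k det by (simp_all add: uv)
qed

lemma SL2_eq_pair:
  assumes "x \<in> carrier (SL2 P)"
  shows "x = zip_mat2 k (map_mat2 f x) (map_mat2 g x)"
  by (rule SL2_joint_inj[OF assms]) (simp_all add: SL2_pair assms SL2_compat)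

end

text \<open>Compatibility and pairing are coefficientwise, so only the finite support of a paired
  sequence needs an argument: beyond both degrees both projections vanish. Iterating the lemma adds
  one variable at a time.\<close>

lemma fibre_product_UP:
  assumes "fibre_product P R S D k f g"
  shows "fibre_product (UP P) (UP R) (UP S) (pmap ` D) (\<lambda>p q n. k (p n) (q n)) (pmap f) (pmap g)"
proof -
  interpret fibre_product P R S D k f g by fact
  show ?thesis
  proof (rule fibre_product.intro)
    show "cring (UP P)" "cring (UP R)" "cring (UP S)" by (intro cring_UP P R S)+
    show "pmap f \<in> ring_hom (UP P) (UP R)" "pmap g \<in> ring_hom (UP P) (UP S)" by (intro pmap_hom f g P R S)+
    show "pmap ` D \<subseteq> ring_hom (UP R) (UP S)" using D by (auto intro: pmap_hom R S)
  next
    fix x d' assume x: "x \<in> carrier (UP P)" and "d' \<in> pmap ` D"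
    then obtain d where d: "d \<in> D" "d' = pmap d" by auto
    show "d' (pmap f x) = pmap g x"
      unfolding d(2) pmap_def by (rule ext) (rule compat[OF UP_coeff_closed[OF x] d(1)])
  next
    fix x y assume xy: "x \<in> carrier (UP P)" "y \<in> carrier (UP P)" "pmap f x = pmap f y" "pmap g x = pmap g y"
    show "x = y"
    proof
      fix n show "x n = y n"
        using xy(3,4) by (intro joint_inj UP_coeff_closed[OF xy(1)] UP_coeff_closed[OF xy(2)]) (simp_all add: pmap_def fun_eq_iff)
    qed
  next
    fix p q assume p: "p \<in> carrier (UP R)" and q: "q \<in> carrier (UP S)" and d: "\<And>d. d \<in> pmap ` D \<Longrightarrow> d p = q"
    have d': "d (p n) = q n" if "d \<in> D" for d n using d[of "pmap d"] that by (auto simp: pmap_def fun_eq_iff)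
    have k: "k (p n) (q n) \<in> carrier P \<and> f (k (p n) (q n)) = p n \<and> g (k (p n) (q n)) = q n" for n
      using pair[of "p n" "q n"] UP_coeff_closed[OF p] UP_coeff_closed[OF q] d' by blast
    obtain m m' where "\<forall>n>m. p n = \<zero>\<^bsub>R\<^esub>" "\<forall>n>m'. q n = \<zero>\<^bsub>S\<^esub>" using p q by (auto simp: mem_UP)
    then have "k (p n) (q n) = \<zero>\<^bsub>P\<^esub>" if "n > max m m'" for n
      using joint_inj[OF conjunct1[OF k[of n]] f.R.zero_closed] k[of n] that by simp
    then have "(\<lambda>n. k (p n) (q n)) \<in> carrier (UP P)" using k unfolding mem_UP by blast
    then show "(\<lambda>n. k (p n) (q n)) \<in> carrier (UP P) \<and> pmap f (\<lambda>n. k (p n) (q n)) = p \<and> pmap g (\<lambda>n. k (p n) (q n)) = q"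
      using k by (simp add: pmap_def)
  qed
qed

context fibre_product
begin

lemma loops_iff:
  assumes x: "x \<in> carrier (SL2 (UP P))"
  shows "x \<in> loops P \<longleftrightarrow> map_mat2 (pmap f) x \<in> loops R \<and> map_mat2 (pmap g) x \<in> loops S"
proof
  assume "x \<in> loops P"
  then show "map_mat2 (pmap f) x \<in> loops R \<and> map_mat2 (pmap g) x \<in> loops S"
    using loops_map[OF f P R] loops_map[OF g P S] by blast
next
  interpret o0: group_hom "SL2 (UP P)" "SL2 P" "at_outer P \<zero>\<^bsub>P\<^esub>" by (rule at_outer_hom[OF P f.R.zero_closed])
  interpret o1: group_hom "SL2 (UP P)" "SL2 P" "at_outer P \<one>\<^bsub>P\<^esub>" by (rule at_outer_hom[OF P f.R.one_closed])
  assume fg: "map_mat2 (pmap f) x \<in> loops R \<and> map_mat2 (pmap g) x \<in> loops S"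
  have "at_outer P \<zero>\<^bsub>P\<^esub> x = \<one>\<^bsub>SL2 P\<^esub>" "at_outer P \<one>\<^bsub>P\<^esub> x = \<one>\<^bsub>SL2 P\<^esub>"
    using x at_outer_pmap01[OF f P R x] at_outer_pmap01[OF g P S x]
      loopsD(2,3)[OF conjunct1[OF fg]] loopsD(2,3)[OF conjunct2[OF fg]]
    by (auto intro!: SL2_joint_inj)
  then show "x \<in> loops P" using x by (simp add: loops_def)
qed

text \<open>Paths to the two projections of x must be compatible under \<open>D\<close> all along,
  not just at their ends, in order to form one path over \<open>P\<close>. For
  \<open>B_ring A\<close> it is this discrepancy that \<open>chi\<close> records.\<close>

lemma QL2_pairI:
  assumes x: "x \<in> carrier (SL2 P)"
    and u: "u \<in> carrier (SL2 (UP R))" "at_outer R \<zero>\<^bsub>R\<^esub> u = \<one>\<^bsub>SL2 R\<^esub>" "at_outer R \<one>\<^bsub>R\<^esub> u = map_mat2 f x"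
    and v: "v \<in> carrier (SL2 (UP S))" "at_outer S \<zero>\<^bsub>S\<^esub> v = \<one>\<^bsub>SL2 S\<^esub>" "at_outer S \<one>\<^bsub>S\<^esub> v = map_mat2 g x"
    and d: "\<And>d. d \<in> D \<Longrightarrow> map_mat2 (pmap d) u = v"
  shows "x \<in> QL2 P"
proof -
  interpret U: fibre_product "UP P" "UP R" "UP S" "pmap ` D" "\<lambda>p q n. k (p n) (q n)" "pmap f" "pmap g"
    by (rule fibre_product_UP[OF fibre_product_axioms])
  interpret o0: group_hom "SL2 (UP P)" "SL2 P" "at_outer P \<zero>\<^bsub>P\<^esub>" by (rule at_outer_hom[OF P f.R.zero_closed])
  interpret o1: group_hom "SL2 (UP P)" "SL2 P" "at_outer P \<one>\<^bsub>P\<^esub>" by (rule at_outer_hom[OF P f.R.one_closed])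
  define w where "w = zip_mat2 (\<lambda>p q n. k (p n) (q n)) u v"
  have w: "w \<in> carrier (SL2 (UP P))" "map_mat2 (pmap f) w = u" "map_mat2 (pmap g) w = v"
    unfolding w_def using d by (intro U.SL2_pair u v; auto)+
  have "at_outer P \<zero>\<^bsub>P\<^esub> w = \<one>\<^bsub>SL2 P\<^esub>" "at_outer P \<one>\<^bsub>P\<^esub> w = x"
    using w x u v at_outer_pmap01[OF f P R w(1)] at_outer_pmap01[OF g P S w(1)]
    by (auto intro!: SL2_joint_inj)
  then show ?thesis using w x by (auto simp: QL2_def)
qed

text \<open>With \<open>D\<close> empty the two null-homotopies can be chosen independently of each
  other; they are paired over the doubly nested polynomial ring.\<close>

lemma null_loops_pairI:
  assumes D: "D = {}" and x: "x \<in> carrier (SL2 (UP P))"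
    and u: "map_mat2 (pmap f) x \<in> null_loops R" and v: "map_mat2 (pmap g) x \<in> null_loops S"
  shows "x \<in> null_loops P"
proof -
  interpret U: fibre_product "UP P" "UP R" "UP S" "pmap ` D" "\<lambda>p q n. k (p n) (q n)" "pmap f" "pmap g"
    by (rule fibre_product_UP[OF fibre_product_axioms])
  interpret UU: fibre_product "UP (UP P)" "UP (UP R)" "UP (UP S)" "pmap ` pmap ` D" "\<lambda>p q n m. k (p n m) (q n m)" "pmap (pmap f)" "pmap (pmap g)"
    using fibre_product_UP[OF fibre_product_UP[OF fibre_product_axioms]] by simp
  obtain c where c: "c \<in> carrier (SL2 (UP (UP R)))" "at_outer (UP R) \<zero>\<^bsub>UP R\<^esub> c = \<one>\<^bsub>SL2 (UP R)\<^esub>"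
      "at_outer (UP R) \<one>\<^bsub>UP R\<^esub> c = map_mat2 (pmap f) x" "at_inner R \<zero>\<^bsub>R\<^esub> c = \<one>\<^bsub>SL2 (UP R)\<^esub>"
      "at_inner R \<one>\<^bsub>R\<^esub> c = \<one>\<^bsub>SL2 (UP R)\<^esub>" using u by (auto simp: null_loops_def)
  obtain e where e: "e \<in> carrier (SL2 (UP (UP S)))" "at_outer (UP S) \<zero>\<^bsub>UP S\<^esub> e = \<one>\<^bsub>SL2 (UP S)\<^esub>"
      "at_outer (UP S) \<one>\<^bsub>UP S\<^esub> e = map_mat2 (pmap g) x" "at_inner S \<zero>\<^bsub>S\<^esub> e = \<one>\<^bsub>SL2 (UP S)\<^esub>"
      "at_inner S \<one>\<^bsub>S\<^esub> e = \<one>\<^bsub>SL2 (UP S)\<^esub>" using v by (auto simp: null_loops_def)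
  define w where "w = zip_mat2 (\<lambda>p q n m. k (p n m) (q n m)) c e"
  have w: "w \<in> carrier (SL2 (UP (UP P)))" "map_mat2 (pmap (pmap f)) w = c" "map_mat2 (pmap (pmap g)) w = e"
    unfolding w_def using D by (intro UU.SL2_pair c e; auto)+
  interpret o0: group_hom "SL2 (UP (UP P))" "SL2 (UP P)" "at_outer (UP P) \<zero>\<^bsub>UP P\<^esub>" by (rule at_outer_hom[OF U.P U.f.R.zero_closed])
  interpret o1: group_hom "SL2 (UP (UP P))" "SL2 (UP P)" "at_outer (UP P) \<one>\<^bsub>UP P\<^esub>" by (rule at_outer_hom[OF U.P U.f.R.one_closed])
  interpret i0: group_hom "SL2 (UP (UP P))" "SL2 (UP P)" "at_inner P \<zero>\<^bsub>P\<^esub>" by (rule at_inner_hom[OF P f.R.zero_closed])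
  interpret i1: group_hom "SL2 (UP (UP P))" "SL2 (UP P)" "at_inner P \<one>\<^bsub>P\<^esub>" by (rule at_inner_hom[OF P f.R.one_closed])
  have outer: "at_outer (UP P) \<zero>\<^bsub>UP P\<^esub> w = \<one>\<^bsub>SL2 (UP P)\<^esub>" "at_outer (UP P) \<one>\<^bsub>UP P\<^esub> w = x"
    using w x c e at_outer_pmap01[OF U.f U.P U.R w(1)] at_outer_pmap01[OF U.g U.P U.S w(1)]
    by (auto intro!: U.SL2_joint_inj)
  have "map_mat2 (pmap f) (at_inner P r w) = at_inner R (f r) c" if "r \<in> carrier P" for r
    unfolding at_inner_pmap w(2)[symmetric]
    by (rule SL2_UP_comp_cong[OF w(1)]) (rule eval_pmap[OF f P R that, symmetric])
  moreover have "map_mat2 (pmap g) (at_inner P r w) = at_inner S (g r) e" if "r \<in> carrier P" for r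
    unfolding at_inner_pmap w(3)[symmetric]
    by (rule SL2_UP_comp_cong[OF w(1)]) (rule eval_pmap[OF g P S that, symmetric])
  ultimately have inner: "at_inner P \<zero>\<^bsub>P\<^esub> w = \<one>\<^bsub>SL2 (UP P)\<^esub>" "at_inner P \<one>\<^bsub>P\<^esub> w = \<one>\<^bsub>SL2 (UP P)\<^esub>"
    using w c e by (auto intro!: U.SL2_joint_inj)
  show ?thesis
    unfolding null_loops_def using w(1) outer inner by (intro image_eqI[of _ _ w]) auto
qed

end

section \<open>The product ring and the ring B\<close>

lemma RDirProd_ops:
  "(a, b) \<otimes>\<^bsub>RDirProd R S\<^esub> (c, d) = (a \<otimes>\<^bsub>R\<^esub> c, b \<otimes>\<^bsub>S\<^esub> d)"
  "(a, b) \<oplus>\<^bsub>RDirProd R S\<^esub> (c, d) = (a \<oplus>\<^bsub>R\<^esub> c, b \<oplus>\<^bsub>S\<^esub> d)"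
  "\<one>\<^bsub>RDirProd R S\<^esub> = (\<one>\<^bsub>R\<^esub>, \<one>\<^bsub>S\<^esub>)" "\<zero>\<^bsub>RDirProd R S\<^esub> = (\<zero>\<^bsub>R\<^esub>, \<zero>\<^bsub>S\<^esub>)"
  by (simp_all add: RDirProd_def DirProd_def monoid.defs)

lemma B_ring_ops:
  "x \<otimes>\<^bsub>B_ring A\<^esub> y = x \<otimes>\<^bsub>RDirProd (UP A) A\<^esub> y" "x \<oplus>\<^bsub>B_ring A\<^esub> y = x \<oplus>\<^bsub>RDirProd (UP A) A\<^esub> y"
  "\<one>\<^bsub>B_ring A\<^esub> = \<one>\<^bsub>RDirProd (UP A) A\<^esub>" "\<zero>\<^bsub>B_ring A\<^esub> = \<zero>\<^bsub>RDirProd (UP A) A\<^esub>"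
  by (simp_all add: B_ring_def)

lemma mem_B_ring:
  "x \<in> carrier (B_ring A) \<longleftrightarrow> fst x \<in> carrier (UP A) \<and> snd x \<in> carrier A \<and>
    eval A A id \<zero>\<^bsub>A\<^esub> (fst x) = snd x \<and> eval A A id \<one>\<^bsub>A\<^esub> (fst x) = snd x"
  by (auto simp: B_ring_def)

lemma cring_RDirProd:
  assumes "cring R" "cring S"
  shows "cring (RDirProd R S)"
proof -
  interpret R: cring R by fact
  interpret S: cring S by fact
  interpret ring "RDirProd R S" by (rule RDirProd_ring) (rule R.ring_axioms S.ring_axioms)+
  show ?thesis by unfold_locales (auto simp: RDirProd_carrier RDirProd_ops R.m_comm S.m_comm)
qed

lemma fibre_product_prod:
  assumes "cring R" "cring S"
  shows "fibre_product (RDirProd R S) R S {} Pair fst snd"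
  by (rule fibre_product.intro)
    (use assms in \<open>auto simp: RDirProd_carrier RDirProd_ops cring_RDirProd intro!: ring_hom_memI\<close>)

lemma cring_B_ring:
  assumes A: "cring A"
  shows "cring (B_ring A)"
proof -
  interpret A: cring A by fact
  interpret U: cring "UP A" by (rule cring_UP) fact
  interpret e0: ring_hom_cring "UP A" A "eval A A id \<zero>\<^bsub>A\<^esub>"
    by (intro ring_hom_cringI cring_UP A eval_hom A.zero_closed)
  interpret e1: ring_hom_cring "UP A" A "eval A A id \<one>\<^bsub>A\<^esub>"
    by (intro ring_hom_cringI cring_UP A eval_hom A.one_closed)
  have "abelian_group (B_ring A)"
  proof (rule abelian_groupI)
    fix x assume x: "x \<in> carrier (B_ring A)"
    show "\<exists>y\<in>carrier (B_ring A). y \<oplus>\<^bsub>B_ring A\<^esub> x = \<zero>\<^bsub>B_ring A\<^esub>"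
      using x by (intro bexI[of _ "(\<ominus>\<^bsub>UP A\<^esub> fst x, \<ominus>\<^bsub>A\<^esub> snd x)"])
        (cases x; simp add: mem_B_ring B_ring_ops RDirProd_ops U.l_neg A.l_neg)+
  qed (auto simp: mem_B_ring B_ring_ops RDirProd_ops A.a_ac U.a_ac)
  moreover have "comm_monoid (B_ring A)"
    by (rule comm_monoidI) (auto simp: mem_B_ring B_ring_ops RDirProd_ops A.m_ac U.m_ac)
  ultimately show ?thesis
    by (rule cringI) (auto simp: mem_B_ring B_ring_ops RDirProd_ops A.l_distr U.l_distr)
qed

lemma fibre_product_B_ring:
  assumes A: "cring A"
  shows "fibre_product (B_ring A) (UP A) A {eval A A id \<zero>\<^bsub>A\<^esub>, eval A A id \<one>\<^bsub>A\<^esub>} Pair fst snd"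
proof -
  interpret A: cring A by fact
  show ?thesis
  proof (rule fibre_product.intro)
    show "fst \<in> ring_hom (B_ring A) (UP A)" "snd \<in> ring_hom (B_ring A) A"
      by (auto intro!: ring_hom_memI simp: mem_B_ring B_ring_ops RDirProd_ops)
    show "{eval A A id \<zero>\<^bsub>A\<^esub>, eval A A id \<one>\<^bsub>A\<^esub>} \<subseteq> ring_hom (UP A) A"
      by (simp add: eval_hom[OF A])
  qed (auto simp: cring_B_ring cring_UP A mem_B_ring prod_eq_iff)
qed

context fibre_product
begin

lemma QL2_prodI:
  assumes D: "D = {}" and x: "x \<in> carrier (SL2 P)"
    and u: "map_mat2 f x \<in> QL2 R" and v: "map_mat2 g x \<in> QL2 S"
  shows "x \<in> QL2 P"
proof -
  obtain a where a: "a \<in> carrier (SL2 (UP R))" "at_outer R \<zero>\<^bsub>R\<^esub> a = \<one>\<^bsub>SL2 R\<^esub>" "at_outer R \<one>\<^bsub>R\<^esub> a = map_mat2 f x"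
    using u by (auto simp: QL2_def)
  obtain b where b: "b \<in> carrier (SL2 (UP S))" "at_outer S \<zero>\<^bsub>S\<^esub> b = \<one>\<^bsub>SL2 S\<^esub>" "at_outer S \<one>\<^bsub>S\<^esub> b = map_mat2 g x"
    using v by (auto simp: QL2_def)
  show ?thesis by (rule QL2_pairI[OF x a b]) (simp add: D)
qed

lemma Gam_class_eqI:
  assumes D: "D = {}" and x: "x \<in> carrier (SL2 P)" and y: "y \<in> carrier (SL2 P)"
    and u: "Gam_class R (map_mat2 f x) = Gam_class R (map_mat2 f y)"
    and v: "Gam_class S (map_mat2 g x) = Gam_class S (map_mat2 g y)"
  shows "Gam_class P x = Gam_class P y"
proof -
  interpret NP: normal "QL2 P" "SL2 P" by (rule normal_QL2[OF P])
  have "map_mat2 f (x \<otimes>\<^bsub>SL2 P\<^esub> inv\<^bsub>SL2 P\<^esub> y) \<in> QL2 R" "map_mat2 g (x \<otimes>\<^bsub>SL2 P\<^esub> inv\<^bsub>SL2 P\<^esub> y) \<in> QL2 S"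
    using u v x y by (simp_all add: Gam_class_def normal.rcos_eq_iff[OF normal_QL2[OF R]] normal.rcos_eq_iff[OF normal_QL2[OF S]])
  then show ?thesis
    using x y by (simp add: Gam_class_def NP.rcos_eq_iff QL2_prodI[OF D])
qed

lemma loop_class_eqI:
  assumes D: "D = {}" and x: "x \<in> loops P" and y: "y \<in> loops P"
    and u: "loop_class R (map_mat2 (pmap f) x) = loop_class R (map_mat2 (pmap f) y)"
    and v: "loop_class S (map_mat2 (pmap g) x) = loop_class S (map_mat2 (pmap g) y)"
  shows "loop_class P x = loop_class P y"
proof -
  interpret NP: normal "null_loops P" "SL2 (UP P)" by (rule normal_null_loops[OF P])
  interpret U: fibre_product "UP P" "UP R" "UP S" "pmap ` D" "\<lambda>p q n. k (p n) (q n)" "pmap f" "pmap g"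
    by (rule fibre_product_UP[OF fibre_product_axioms])
  note xy = loopsD(1)[OF x] loopsD(1)[OF y]
  have "map_mat2 (pmap f) (x \<otimes>\<^bsub>SL2 (UP P)\<^esub> inv\<^bsub>SL2 (UP P)\<^esub> y) \<in> null_loops R"
    "map_mat2 (pmap g) (x \<otimes>\<^bsub>SL2 (UP P)\<^esub> inv\<^bsub>SL2 (UP P)\<^esub> y) \<in> null_loops S"
    using u v xy loops_map[OF f P R x] loops_map[OF f P R y] loops_map[OF g P S x] loops_map[OF g P S y]
    by (simp_all add: loop_class_rcos[OF R] loop_class_rcos[OF S]
        normal.rcos_eq_iff[OF normal_null_loops[OF R]] normal.rcos_eq_iff[OF normal_null_loops[OF S]])
  then show ?thesis
    using xy by (simp add: loop_class_rcos[OF P] x y NP.rcos_eq_iff null_loops_pairI[OF D])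
qed

end

section \<open>Functoriality of classes and unions over representatives\<close>

lemma loop_class_map_cong:
  assumes g: "g \<in> ring_hom R S" and R: "cring R" and S: "cring S"
    and x: "x \<in> loops R" and y: "y \<in> loops R" and "loop_class R x = loop_class R y"
  shows "loop_class S (map_mat2 (pmap g) x) = loop_class S (map_mat2 (pmap g) y)"
  using rcos_hom_cong[OF pmap_SL2_hom[OF R S g] normal_null_loops[OF R] normal_null_loops[OF S] null_loops_map[OF g R S]
      loopsD(1)[OF x] loopsD(1)[OF y]] assms
  by (simp add: loop_class_rcos loops_map[OF g R S])

lemma Gam_class_map_cong:
  assumes g: "g \<in> ring_hom R S" and R: "cring R" and S: "cring S"
    and x: "x \<in> carrier (SL2 R)" and y: "y \<in> carrier (SL2 R)" and "Gam_class R x = Gam_class R y"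
  shows "Gam_class S (map_mat2 g x) = Gam_class S (map_mat2 g y)"
  using rcos_hom_cong[OF map_SL2_hom[OF R S g] normal_QL2[OF R] normal_QL2[OF S] QL2_map[OF g R S] x y] assms
  by (simp add: Gam_class_def)

lemma loop_class_self: "cring R \<Longrightarrow> x \<in> loops R \<Longrightarrow> x \<in> loop_class R x"
  using group.rcos_self[OF cring.group_SL2[OF cring_UP] loopsD(1) normal_imp_subgroup[OF normal_null_loops]]
  by (simp add: loop_class_rcos)

lemma loop_classD:
  assumes R: "cring R" and x: "x \<in> loops R" and y: "y \<in> loop_class R x"
  shows "y \<in> loops R" "loop_class R y = loop_class R x"
proof -
  show y': "y \<in> loops R" using y by (auto simp: loop_class_def loop_rel_def)
  show "loop_class R y = loop_class R x"
    using group.repr_independence[OF cring.group_SL2[OF cring_UP[OF R]] _ loopsD(1)[OF x] normal_imp_subgroup[OF normal_null_loops[OF R]], of y] y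
    by (simp add: loop_class_rcos R x y')
qed

lemma Gam_class_self: "cring R \<Longrightarrow> x \<in> carrier (SL2 R) \<Longrightarrow> x \<in> Gam_class R x"
  unfolding Gam_class_def
  by (rule group.rcos_self[OF cring.group_SL2 _ normal_imp_subgroup[OF normal_QL2]])

lemma Gam_classD:
  assumes R: "cring R" and x: "x \<in> carrier (SL2 R)" and y: "y \<in> Gam_class R x"
  shows "y \<in> carrier (SL2 R)" "Gam_class R y = Gam_class R x"
proof -
  interpret N: normal "QL2 R" "SL2 R" by (rule normal_QL2[OF R])
  show "y \<in> carrier (SL2 R)" using y x N.r_coset_subset_G[OF N.subset x] by (auto simp: Gam_class_def)
  show "Gam_class R y = Gam_class R x"
    using N.repr_independence[OF _ x N.subgroup_axioms] y by (simp add: Gam_class_def)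
qed

text \<open>The maps of the sequence are unions over all representatives. A union of equal classes
  is that class as soon as there is one representative, which is why a member of c is
  required.\<close>

lemma UN_const: "a \<in> c \<Longrightarrow> (\<And>x. x \<in> c \<Longrightarrow> F x = F a) \<Longrightarrow> (\<Union>x\<in>c. F x) = F a"
  by blast

lemma UN2_const:
  "a \<in> c \<Longrightarrow> b \<in> d \<Longrightarrow> (\<And>x y. x \<in> c \<Longrightarrow> y \<in> d \<Longrightarrow> F x y = F a b) \<Longrightarrow> (\<Union>x\<in>c. \<Union>y\<in>d. F x y) = F a b"
  by blast

lemma carrier_pi1: "carrier (pi1 R) = loop_class R ` loops R"
  by (auto simp: pi1_def quotient_def loop_class_def)

lemma carrier_Gam: "carrier (Gam R) = Gam_class R ` carrier (SL2 R)"
  by (auto simp: Gam_def carrier_FactGroup Gam_class_def)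

lemma one_in_loops: "cring R \<Longrightarrow> \<one>\<^bsub>SL2 (UP R)\<^esub> \<in> loops R"
  by (rule subgroup.one_closed[OF subgroup_loops])

text \<open>With this and its analogue for \<open>Gam\<close>, lying in a kernel becomes membership
  of a matrix in a normal subgroup.\<close>

lemma loop_class_eq_one:
  assumes R: "cring R" and x: "x \<in> loops R"
  shows "loop_class R x = \<one>\<^bsub>pi1 R\<^esub> \<longleftrightarrow> x \<in> null_loops R"
proof -
  interpret N: normal "null_loops R" "SL2 (UP R)" by (rule normal_null_loops[OF R])
  show ?thesis
    using loopsD(1)[OF x] by (simp add: pi1_def loop_class_rcos[OF R] x one_in_loops R N.rcos_eq_iff)
qed

lemma Gam_class_eq_one:
  assumes R: "cring R" and x: "x \<in> carrier (SL2 R)"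
  shows "Gam_class R x = \<one>\<^bsub>Gam R\<^esub> \<longleftrightarrow> x \<in> QL2 R"
proof -
  interpret N: normal "QL2 R" "SL2 R" by (rule normal_QL2[OF R])
  have "\<one>\<^bsub>Gam R\<^esub> = QL2 R #>\<^bsub>SL2 R\<^esub> \<one>\<^bsub>SL2 R\<^esub>" by (simp add: Gam_def N.subset)
  then show ?thesis using x by (simp add: Gam_class_def N.rcos_eq_iff)
qed

section \<open>The exact sequence\<close>

lemma fst_pmat_pmap: "fst_pmat = map_mat2 (pmap fst)"
  by (simp add: fst_pmat_def pmap_def[abs_def])

lemma snd_pmat_pmap: "snd_pmat = map_mat2 (pmap snd)"
  by (simp add: snd_pmat_def pmap_def[abs_def])

text \<open>M is studied for paths and not just for loops, because exactness at the last interior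
  term glues two paths whose end points are arbitrary.\<close>

definition paths :: "('a, 'm) ring_scheme \<Rightarrow> (nat \<Rightarrow> 'a) mat2 set" where
  "paths R = {a \<in> carrier (SL2 (UP R)). at_outer R \<zero>\<^bsub>R\<^esub> a = \<one>\<^bsub>SL2 R\<^esub>}"

lemma loops_paths: "x \<in> loops R \<Longrightarrow> x \<in> paths R"
  by (simp add: loops_def paths_def)

lemma pathsD: "x \<in> paths R \<Longrightarrow> x \<in> carrier (SL2 (UP R))" "x \<in> paths R \<Longrightarrow> at_outer R \<zero>\<^bsub>R\<^esub> x = \<one>\<^bsub>SL2 R\<^esub>"
  by (simp_all add: paths_def)

lemma QL2E:
  assumes "x \<in> QL2 R" obtains a where "a \<in> paths R" "at_outer R \<one>\<^bsub>R\<^esub> a = x"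
  using assms by (auto simp: QL2_def paths_def)

context
  fixes A :: "('a, 'm) ring_scheme"
  assumes A: "cring A"
begin

interpretation A: cring A by (rule A)
interpretation UA: cring "UP A" by (rule cring_UP[OF A])
interpretation UUA: cring "UP (UP A)" by (rule cring_UP[OF UA.is_cring])

interpretation e0: ring_hom_cring "UP A" A "eval A A id \<zero>\<^bsub>A\<^esub>"
  by (rule ring_hom_cringI[OF UA.is_cring A eval_hom[OF A A.zero_closed]])
interpretation e1: ring_hom_cring "UP A" A "eval A A id \<one>\<^bsub>A\<^esub>"
  by (rule ring_hom_cringI[OF UA.is_cring A eval_hom[OF A A.one_closed]])

interpretation G0: group "SL2 A" by (rule A.group_SL2)
interpretation G1: group "SL2 (UP A)" by (rule UA.group_SL2)
interpretation G2: group "SL2 (UP (UP A))" by (rule UUA.group_SL2)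

interpretation o0: group_hom "SL2 (UP A)" "SL2 A" "at_outer A \<zero>\<^bsub>A\<^esub>" by (rule at_outer_hom[OF A A.zero_closed])
interpretation o1: group_hom "SL2 (UP A)" "SL2 A" "at_outer A \<one>\<^bsub>A\<^esub>" by (rule at_outer_hom[OF A A.one_closed])
interpretation oU0: group_hom "SL2 (UP (UP A))" "SL2 (UP A)" "at_outer (UP A) \<zero>\<^bsub>UP A\<^esub>"
  by (rule at_outer_hom[OF UA.is_cring UA.zero_closed])
interpretation oU1: group_hom "SL2 (UP (UP A))" "SL2 (UP A)" "at_outer (UP A) \<one>\<^bsub>UP A\<^esub>"
  by (rule at_outer_hom[OF UA.is_cring UA.one_closed])
interpretation i0: group_hom "SL2 (UP (UP A))" "SL2 (UP A)" "at_inner A \<zero>\<^bsub>A\<^esub>" by (rule at_inner_hom[OF A A.zero_closed])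
interpretation i1: group_hom "SL2 (UP (UP A))" "SL2 (UP A)" "at_inner A \<one>\<^bsub>A\<^esub>" by (rule at_inner_hom[OF A A.one_closed])
interpretation c: group_hom "SL2 A" "SL2 (UP A)" "map_mat2 (cst A)" by (rule cst_SL2_hom[OF A])
interpretation k: group_hom "SL2 (UP A)" "SL2 (UP (UP A))" "map_mat2 (pmap (cst A))"
  by (rule pmap_SL2_hom[OF A UA.is_cring cst_hom[OF A]])

interpretation B: fibre_product "B_ring A" "UP A" A "{eval A A id \<zero>\<^bsub>A\<^esub>, eval A A id \<one>\<^bsub>A\<^esub>}" Pair fst snd
  by (rule fibre_product_B_ring[OF A])
interpretation BU: fibre_product "UP (B_ring A)" "UP (UP A)" "UP A" "pmap ` {eval A A id \<zero>\<^bsub>A\<^esub>, eval A A id \<one>\<^bsub>A\<^esub>}"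
  "\<lambda>p q n. (p n, q n)" "pmap fst" "pmap snd"
  by (rule fibre_product_UP[OF B.fibre_product_axioms])
interpretation P: fibre_product "RDirProd A A" A A "{}" Pair fst snd by (rule fibre_product_prod[OF A A])
interpretation PU: fibre_product "UP (RDirProd A A)" "UP A" "UP A" "pmap ` {}" "\<lambda>p q n. (p n, q n)" "pmap fst" "pmap snd"
  by (rule fibre_product_UP[OF P.fibre_product_axioms])

interpretation NB: normal "QL2 (B_ring A)" "SL2 (B_ring A)" by (rule normal_QL2[OF B.P])

section \<open>The matrix M\<close>

abbreviation (input) tX where "tX \<equiv> monom (UP A) \<one>\<^bsub>A\<^esub> 1"
abbreviation (input) tY where "tY \<equiv> \<one>\<^bsub>UP A\<^esub> \<ominus>\<^bsub>UP A\<^esub> tX"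

lemma tX: "tX \<in> carrier (UP A)" "eval A A id \<zero>\<^bsub>A\<^esub> tX = \<zero>\<^bsub>A\<^esub>" "eval A A id \<one>\<^bsub>A\<^esub> tX = \<one>\<^bsub>A\<^esub>"
  by (rule UP_monom_closed[OF A A.one_closed])
    (simp_all add: eval_monom_id[OF A A.zero_closed A.one_closed] eval_monom_id[OF A A.one_closed A.one_closed])

lemma tY: "tY \<in> carrier (UP A)" "eval A A id \<zero>\<^bsub>A\<^esub> tY = \<one>\<^bsub>A\<^esub>" "eval A A id \<one>\<^bsub>A\<^esub> tY = \<zero>\<^bsub>A\<^esub>"
  using tX by (simp_all add: a_minus_def A.r_neg)

lemma subst2_dil:
  assumes "q \<in> carrier (UP A)" "x \<in> carrier (SL2 (UP A))"
  shows "subst2 A (monom (UP (UP A)) q 1) x = map_mat2 (dil (UP A) (cst A) q) x"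
  unfolding subst2_def
  by (rule map_mat2_SL2_cong[OF assms(2)])
    (use eval_eq_dil[OF cst_hom[OF A] A UA.is_cring assms(1)] in \<open>simp add: cst_def\<close>)

lemma chi_M_glue:
  assumes "a \<in> paths A" "b \<in> paths A"
  shows "chi_M A a b = glue (UP A) (cst A) tY tX a b"
  using subst2_dil[OF tY(1) pathsD(1)[OF assms(1)]] subst2_dil[OF tX(1) pathsD(1)[OF assms(2)]]
  by (simp add: chi_M_def glue_def Let_def)

lemma eval_cst: "r \<in> carrier A \<Longrightarrow> a \<in> carrier A \<Longrightarrow> eval A A id r (cst A a) = a"
  by (simp add: cst_def eval_monom_id[OF A])

text \<open>All later arguments use M through these four facts: it is a path over A[X] whose ends at
  X = 0 and X = 1 are prescribed paths over A.\<close>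

lemma chi_M:
  assumes "a \<in> paths A" "b \<in> paths A"
  shows "chi_M A a b \<in> carrier (SL2 (UP (UP A)))" "at_outer (UP A) \<zero>\<^bsub>UP A\<^esub> (chi_M A a b) = \<one>\<^bsub>SL2 (UP A)\<^esub>"
    "at_inner A \<zero>\<^bsub>A\<^esub> (chi_M A a b) = a" "at_inner A \<one>\<^bsub>A\<^esub> (chi_M A a b) = b"
proof -
  note h = A UA.is_cring cst_hom[OF A] tY(1) tX(1) pathsD[OF assms(1)] pathsD[OF assms(2)]
  show "chi_M A a b \<in> carrier (SL2 (UP (UP A)))" "at_outer (UP A) \<zero>\<^bsub>UP A\<^esub> (chi_M A a b) = \<one>\<^bsub>SL2 (UP A)\<^esub>"
    unfolding chi_M_glue[OF assms] by (rule glue_closed[OF h] glue_at_zero[OF h])+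
  show "at_inner A \<zero>\<^bsub>A\<^esub> (chi_M A a b) = a"
    unfolding chi_M_glue[OF assms] at_inner_pmap
    by (rule glue_restrict(1)[OF h e0.homh]) (rule eval_cst[OF A.zero_closed] tY(2) tX(2) | assumption)+
  show "at_inner A \<one>\<^bsub>A\<^esub> (chi_M A a b) = b"
    unfolding chi_M_glue[OF assms] at_inner_pmap
    by (rule glue_restrict(2)[OF h e1.homh]) (rule eval_cst[OF A.one_closed] tY(3) tX(3) | assumption)+
qed

lemma at_inner_const:
  assumes "x \<in> carrier (SL2 (UP A))"
  shows "at_inner A \<zero>\<^bsub>A\<^esub> (map_mat2 (pmap (cst A)) x) = x" "at_inner A \<one>\<^bsub>A\<^esub> (map_mat2 (pmap (cst A)) x) = x"
  unfolding at_inner_pmap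
  using SL2_UP_comp_cong[OF assms, of "eval A A id \<zero>\<^bsub>A\<^esub>" "cst A" "\<lambda>a. a" "\<lambda>a. a"]
    SL2_UP_comp_cong[OF assms, of "eval A A id \<one>\<^bsub>A\<^esub>" "cst A" "\<lambda>a. a" "\<lambda>a. a"]
  by (simp_all add: eval_cst pmap_ident)

section \<open>Matrices over B and over the product as pairs\<close>

lemma pair_B:
  assumes "a \<in> carrier (SL2 (UP A))" "b \<in> carrier (SL2 A)" "at_outer A \<zero>\<^bsub>A\<^esub> a = b" "at_outer A \<one>\<^bsub>A\<^esub> a = b"
  shows "pair_mat a b \<in> carrier (SL2 (B_ring A))" "map_mat2 fst (pair_mat a b) = a" "map_mat2 snd (pair_mat a b) = b"
  unfolding pair_mat_def using assms(3,4) by (intro B.SL2_pair[OF assms(1,2)]; auto simp: at_outer_def)+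

lemma SL2_B:
  assumes "x \<in> carrier (SL2 (B_ring A))"
  shows "x = pair_mat (map_mat2 fst x) (map_mat2 snd x)"
    "at_outer A \<zero>\<^bsub>A\<^esub> (map_mat2 fst x) = map_mat2 snd x" "at_outer A \<one>\<^bsub>A\<^esub> (map_mat2 fst x) = map_mat2 snd x"
  unfolding pair_mat_def at_outer_def
  by (rule B.SL2_eq_pair[OF assms]) (simp_all add: B.SL2_compat[OF assms])

lemma pair_UB:
  assumes "a \<in> carrier (SL2 (UP (UP A)))" "b \<in> carrier (SL2 (UP A))" "at_inner A \<zero>\<^bsub>A\<^esub> a = b" "at_inner A \<one>\<^bsub>A\<^esub> a = b"
  shows "pair_pmat a b \<in> carrier (SL2 (UP (B_ring A)))" "map_mat2 (pmap fst) (pair_pmat a b) = a"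
    "map_mat2 (pmap snd) (pair_pmat a b) = b"
  unfolding pair_pmat_def using assms(3,4) by (intro BU.SL2_pair[OF assms(1,2)]; auto simp: at_inner_pmap)+

lemma SL2_UB:
  assumes "x \<in> carrier (SL2 (UP (B_ring A)))"
  shows "x = pair_pmat (map_mat2 (pmap fst) x) (map_mat2 (pmap snd) x)"
    "at_inner A \<zero>\<^bsub>A\<^esub> (map_mat2 (pmap fst) x) = map_mat2 (pmap snd) x"
    "at_inner A \<one>\<^bsub>A\<^esub> (map_mat2 (pmap fst) x) = map_mat2 (pmap snd) x"
  unfolding pair_pmat_def at_inner_pmap
  by (rule BU.SL2_eq_pair[OF assms]) (simp_all add: BU.SL2_compat[OF assms])

lemma pair_P:
  assumes "a \<in> carrier (SL2 A)" "b \<in> carrier (SL2 A)"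
  shows "pair_mat a b \<in> carrier (SL2 (RDirProd A A))" "map_mat2 fst (pair_mat a b) = a" "map_mat2 snd (pair_mat a b) = b"
  unfolding pair_mat_def by (intro P.SL2_pair[OF assms]; simp)+

lemma pair_UP_prod:
  assumes "a \<in> loops A" "b \<in> loops A"
  shows "pair_pmat a b \<in> loops (RDirProd A A)" "map_mat2 (pmap fst) (pair_pmat a b) = a"
    "map_mat2 (pmap snd) (pair_pmat a b) = b"
proof -
  have *: "pair_pmat a b \<in> carrier (SL2 (UP (RDirProd A A)))" "map_mat2 (pmap fst) (pair_pmat a b) = a"
    "map_mat2 (pmap snd) (pair_pmat a b) = b"
    unfolding pair_pmat_def by (intro PU.SL2_pair[OF loopsD(1)[OF assms(1)] loopsD(1)[OF assms(2)]]; simp)+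
  then show "pair_pmat a b \<in> loops (RDirProd A A)" "map_mat2 (pmap fst) (pair_pmat a b) = a"
    "map_mat2 (pmap snd) (pair_pmat a b) = b"
    using assms by (simp_all add: P.loops_iff)
qed

lemma QL2_B_I:
  assumes N: "N \<in> paths (UP A)" and i: "at_inner A \<zero>\<^bsub>A\<^esub> N = b" "at_inner A \<one>\<^bsub>A\<^esub> N = b"
  shows "pair_mat (at_outer (UP A) \<one>\<^bsub>UP A\<^esub> N) (at_outer A \<one>\<^bsub>A\<^esub> b) \<in> QL2 (B_ring A)"
proof -
  note Nc = pathsD(1)[OF N]
  have b: "b \<in> carrier (SL2 (UP A))" using i(1) Nc by auto
  note p = pair_B[OF oU1.hom_closed[OF Nc] o1.hom_closed[OF b]]
  have e: "at_outer A \<zero>\<^bsub>A\<^esub> (at_outer (UP A) \<one>\<^bsub>UP A\<^esub> N) = at_outer A \<one>\<^bsub>A\<^esub> b"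
    "at_outer A \<one>\<^bsub>A\<^esub> (at_outer (UP A) \<one>\<^bsub>UP A\<^esub> N) = at_outer A \<one>\<^bsub>A\<^esub> b"
    by (simp_all add: at_outer_at_outer[OF A _ Nc] i)
  \<comment> \<open>The start of b is the corner N(0,0), hence the identity; so b is a legitimate
    path for the second component.\<close>
  have b0: "at_outer A \<zero>\<^bsub>A\<^esub> b = \<one>\<^bsub>SL2 A\<^esub>"
    using at_outer_at_outer(1)[OF A A.zero_closed Nc] by (simp add: i pathsD(2)[OF N])
  show ?thesis
    by (rule B.QL2_pairI[OF p(1)[OF e] Nc pathsD(2)[OF N] _ b b0])
      (use i in \<open>auto simp: p[OF e] at_inner_pmap\<close>)
qed

lemma QL2_B_E:
  assumes x: "x \<in> QL2 (B_ring A)"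
  obtains N b where "N \<in> paths (UP A)" "at_inner A \<zero>\<^bsub>A\<^esub> N = b" "at_inner A \<one>\<^bsub>A\<^esub> N = b"
    "at_outer (UP A) \<one>\<^bsub>UP A\<^esub> N = map_mat2 fst x" "at_outer A \<one>\<^bsub>A\<^esub> b = map_mat2 snd x" "b \<in> paths A"
proof -
  from x obtain w where w: "w \<in> paths (B_ring A)" "at_outer (B_ring A) \<one>\<^bsub>B_ring A\<^esub> w = x" by (rule QL2E)
  note wc = pathsD(1)[OF w(1)]
  note f = at_outer_pmap01[OF B.f B.P UA.is_cring wc] and g = at_outer_pmap01[OF B.g B.P A wc]
  have "map_mat2 (pmap fst) w \<in> paths (UP A)" "map_mat2 (pmap snd) w \<in> paths A"
    using wc f(1) g(1) by (simp_all add: paths_def pathsD(2)[OF w(1)])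
  then show ?thesis
    using that SL2_UB(2,3)[OF wc] f(2) g(2) w(2) by simp
qed

lemma loops_inner:
  assumes "x \<in> loops (UP A)"
  shows "at_inner A \<zero>\<^bsub>A\<^esub> x \<in> loops A" "at_inner A \<one>\<^bsub>A\<^esub> x \<in> loops A"
  unfolding at_inner_pmap by (rule loops_map[OF _ UA.is_cring A assms], rule e0.homh e1.homh)+

lemma loops_const: "x \<in> loops A \<Longrightarrow> map_mat2 (pmap (cst A)) x \<in> loops (UP A)"
  by (rule loops_map[OF cst_hom[OF A] A UA.is_cring])

text \<open>The corners M(0,1) = a(1) and M(1,1) = b(1) are both the identity, so (M(X,1), 1)
  satisfies the condition defining B. This is where a and b must be closed.\<close>

lemma chi_rep:
  assumes "a \<in> loops A" "b \<in> loops A"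
  shows "chi_rep A a b \<in> carrier (SL2 (B_ring A))"
    "map_mat2 fst (chi_rep A a b) = at_outer (UP A) \<one>\<^bsub>UP A\<^esub> (chi_M A a b)"
    "map_mat2 snd (chi_rep A a b) = \<one>\<^bsub>SL2 A\<^esub>"
proof -
  note M = chi_M[OF loops_paths[OF assms(1)] loops_paths[OF assms(2)]]
  have e: "at_outer A \<zero>\<^bsub>A\<^esub> (at_outer (UP A) \<one>\<^bsub>UP A\<^esub> (chi_M A a b)) = \<one>\<^bsub>SL2 A\<^esub>"
    "at_outer A \<one>\<^bsub>A\<^esub> (at_outer (UP A) \<one>\<^bsub>UP A\<^esub> (chi_M A a b)) = \<one>\<^bsub>SL2 A\<^esub>"
    by (simp_all add: at_outer_at_outer[OF A _ M(1)] M loopsD(3)[OF assms(1)] loopsD(3)[OF assms(2)])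
  show "chi_rep A a b \<in> carrier (SL2 (B_ring A))"
    "map_mat2 fst (chi_rep A a b) = at_outer (UP A) \<one>\<^bsub>UP A\<^esub> (chi_M A a b)"
    "map_mat2 snd (chi_rep A a b) = \<one>\<^bsub>SL2 A\<^esub>"
    unfolding chi_rep_def by (rule pair_B[OF oU1.hom_closed[OF M(1)] G0.one_closed e])+
qed

text \<open>The pair (N, b) is a path in SL_2(B) from the identity to x y^-1, so equality in
  Gamma(B) is settled by exhibiting one matrix N over A[X].\<close>

lemma Gam_class_B_eqI:
  assumes x: "x \<in> carrier (SL2 (B_ring A))" and y: "y \<in> carrier (SL2 (B_ring A))"
    and N: "N \<in> paths (UP A)" and i: "at_inner A \<zero>\<^bsub>A\<^esub> N = b" "at_inner A \<one>\<^bsub>A\<^esub> N = b"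
    and f: "at_outer (UP A) \<one>\<^bsub>UP A\<^esub> N = map_mat2 fst x \<otimes>\<^bsub>SL2 (UP A)\<^esub> inv\<^bsub>SL2 (UP A)\<^esub> map_mat2 fst y"
    and s: "at_outer A \<one>\<^bsub>A\<^esub> b = map_mat2 snd x \<otimes>\<^bsub>SL2 A\<^esub> inv\<^bsub>SL2 A\<^esub> map_mat2 snd y"
  shows "Gam_class (B_ring A) x = Gam_class (B_ring A) y"
proof -
  have "x \<otimes>\<^bsub>SL2 (B_ring A)\<^esub> inv\<^bsub>SL2 (B_ring A)\<^esub> y = pair_mat (at_outer (UP A) \<one>\<^bsub>UP A\<^esub> N) (at_outer A \<one>\<^bsub>A\<^esub> b)"
    using x y by (subst SL2_B(1)) (simp_all add: f s)
  with QL2_B_I[OF N i] show ?thesis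
    unfolding Gam_class_def NB.rcos_eq_iff[OF x y] by simp
qed

lemma chi_rep_shift:
  assumes u: "u \<in> loops (UP A)" and a: "a \<in> loops A" and b: "b \<in> loops A"
    and a': "a' = at_inner A \<zero>\<^bsub>A\<^esub> u \<otimes>\<^bsub>SL2 (UP A)\<^esub> a" and b': "b' = at_inner A \<one>\<^bsub>A\<^esub> u \<otimes>\<^bsub>SL2 (UP A)\<^esub> b"
  shows "Gam_class (B_ring A) (chi_rep A a' b') = Gam_class (B_ring A) (chi_rep A a b)"
proof -
  have l: "a' \<in> loops A" "b' \<in> loops A"
    unfolding a' b' by (intro subgroup.m_closed[OF subgroup_loops[OF A]] loops_inner u a b)+
  note M = chi_M[OF loops_paths[OF a] loops_paths[OF b]]
  note M' = chi_M[OF loops_paths[OF l(1)] loops_paths[OF l(2)]]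
  note uD = loopsD[OF u] and ac = loopsD(1)[OF a] and bc = loopsD(1)[OF b]
  \<comment> \<open>At the ends X = 0, 1 the last factor cancels what u contributed to a' and b',
    leaving the identity. Since u is closed, that factor is trivial at T = 0 and T = 1, so N ends at
    M'(X,1) M(X,1)^-1.\<close>
  define N where "N = chi_M A a' b' \<otimes>\<^bsub>SL2 (UP (UP A))\<^esub> inv\<^bsub>SL2 (UP (UP A))\<^esub> chi_M A a b \<otimes>\<^bsub>SL2 (UP (UP A))\<^esub> inv\<^bsub>SL2 (UP (UP A))\<^esub> u"
  have N: "N \<in> paths (UP A)" using M M' uD by (simp add: N_def paths_def)
  have i: "at_inner A \<zero>\<^bsub>A\<^esub> N = \<one>\<^bsub>SL2 (UP A)\<^esub>" "at_inner A \<one>\<^bsub>A\<^esub> N = \<one>\<^bsub>SL2 (UP A)\<^esub>"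
    using M M' uD ac bc by (simp_all add: N_def a' b' G1.m_assoc)
  show ?thesis
    by (rule Gam_class_B_eqI[OF chi_rep(1)[OF l] chi_rep(1)[OF a b] N i])
      (use M M' uD in \<open>simp_all add: N_def chi_rep[OF l] chi_rep[OF a b]\<close>)
qed


text \<open>A null-homotopy over A is a path in the homotopy variable S over A[T], so gluing applies
  one level up. It gives G(X,T,S) = a(T,(1-X)S) b(T,XS) over A[X][T][S], and u is the end of G at S
  = 1.\<close>

lemma null_loops_extend:
  assumes "v \<in> null_loops A" "w \<in> null_loops A"
  obtains u where "u \<in> null_loops (UP A)" "at_inner A \<zero>\<^bsub>A\<^esub> u = v" "at_inner A \<one>\<^bsub>A\<^esub> u = w"
proof -
  obtain a where a: "a \<in> carrier (SL2 (UP (UP A)))" "at_outer (UP A) \<zero>\<^bsub>UP A\<^esub> a = \<one>\<^bsub>SL2 (UP A)\<^esub>"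
    and a': "at_outer (UP A) \<one>\<^bsub>UP A\<^esub> a = v" "at_inner A \<zero>\<^bsub>A\<^esub> a = \<one>\<^bsub>SL2 (UP A)\<^esub>" "at_inner A \<one>\<^bsub>A\<^esub> a = \<one>\<^bsub>SL2 (UP A)\<^esub>"
    using assms(1) by (auto simp: null_loops_def)
  obtain b where b: "b \<in> carrier (SL2 (UP (UP A)))" "at_outer (UP A) \<zero>\<^bsub>UP A\<^esub> b = \<one>\<^bsub>SL2 (UP A)\<^esub>"
    and b': "at_outer (UP A) \<one>\<^bsub>UP A\<^esub> b = w" "at_inner A \<zero>\<^bsub>A\<^esub> b = \<one>\<^bsub>SL2 (UP A)\<^esub>" "at_inner A \<one>\<^bsub>A\<^esub> b = \<one>\<^bsub>SL2 (UP A)\<^esub>"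
    using assms(2) by (auto simp: null_loops_def)
  note UA = UA.is_cring and UUA = UUA.is_cring
  note c = cst_hom[OF A] and pc = pmap_hom[OF cst_hom[OF A] A UA.is_cring]
  note pe0 = pmap_hom[OF e0.homh UA A] and pe1 = pmap_hom[OF e1.homh UA A]
  \<comment> \<open>The factors 1 - X and X have to live in A[X][T], where they are constant in
    T.\<close>
  define x where "x = cst (UP A) tX"
  define y where "y = cst (UP A) tY"
  have xy: "y \<in> carrier (UP (UP A))" "x \<in> carrier (UP (UP A))"
    unfolding x_def y_def by (rule ring_hom_closed[OF cst_hom[OF UA]], rule tX tY)+
  have pcst: "pmap e (cst (UP A) p) = cst A (e p)" if "e \<in> ring_hom (UP A) A" "p \<in> carrier (UP A)" for e p
    unfolding cst_def by (rule pmap_monom[OF that(1) UA A that(2)])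
  have c01: "cst A \<zero>\<^bsub>A\<^esub> = \<zero>\<^bsub>UP A\<^esub>" "cst A \<one>\<^bsub>A\<^esub> = \<one>\<^bsub>UP A\<^esub>"
    using ring_hom_zero[OF c A.ring_axioms UA.ring_axioms] ring_hom_one[OF c] by simp_all
  have at_xy: "pmap (eval A A id \<zero>\<^bsub>A\<^esub>) y = \<one>\<^bsub>UP A\<^esub>" "pmap (eval A A id \<zero>\<^bsub>A\<^esub>) x = \<zero>\<^bsub>UP A\<^esub>"
    "pmap (eval A A id \<one>\<^bsub>A\<^esub>) y = \<zero>\<^bsub>UP A\<^esub>" "pmap (eval A A id \<one>\<^bsub>A\<^esub>) x = \<one>\<^bsub>UP A\<^esub>"
    unfolding x_def y_def pcst[OF e0.homh tX(1)] pcst[OF e0.homh tY(1)] pcst[OF e1.homh tX(1)] pcst[OF e1.homh tY(1)]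
      tX tY by (rule c01)+
  have pec: "pmap (eval A A id r) (pmap (cst A) p) = p" if "r \<in> carrier A" "p \<in> carrier (UP A)" for r p
    unfolding pmap_def using eval_cst[OF that(1) UP_coeff_closed[OF that(2)]] by simp
  note h = UA UUA pc xy a b
  define G where "G = glue (UP (UP A)) (pmap (cst A)) y x a b"
  have G: "G \<in> carrier (SL2 (UP (UP (UP A))))" "at_outer (UP (UP A)) \<zero>\<^bsub>UP (UP A)\<^esub> G = \<one>\<^bsub>SL2 (UP (UP A))\<^esub>"
    unfolding G_def by (rule glue_closed[OF h] glue_at_zero[OF h])+
  have G0: "map_mat2 (pmap (pmap (eval A A id \<zero>\<^bsub>A\<^esub>))) G = a"
    unfolding G_def by (rule glue_restrict(1)[OF h pe0]) (rule pec[OF A.zero_closed] at_xy | assumption)+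
  have G1: "map_mat2 (pmap (pmap (eval A A id \<one>\<^bsub>A\<^esub>))) G = b"
    unfolding G_def by (rule glue_restrict(2)[OF h pe1]) (rule pec[OF A.one_closed] at_xy | assumption)+
  have comm: "eval (UP A) (UP A) id (cst A r) (pmap (cst A) p) = cst A (eval A A id r p)"
    if "r \<in> carrier A" "p \<in> carrier (UP A)" for r p
    by (rule eval_pmap[OF c A UA that])
  \<comment> \<open>For G the inner variable of \<open>at_inner (UP A)\<close> is T. At T = 0, and
    likewise at T = 1 below, both null-homotopies are trivial, hence so is G for all X and
    S.\<close>
  have "at_inner (UP A) \<zero>\<^bsub>UP A\<^esub> G = \<one>\<^bsub>SL2 (UP (UP A))\<^esub>"
    unfolding G_def at_inner_pmap
    by (rule glue_trivial[OF h A UA eval_hom[OF UA UA.zero_closed] e0.homh c])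
      (use comm[OF A.zero_closed] a' b' in \<open>simp_all add: c01 at_inner_pmap\<close>)
  moreover have "at_inner (UP A) \<one>\<^bsub>UP A\<^esub> G = \<one>\<^bsub>SL2 (UP (UP A))\<^esub>"
    unfolding G_def at_inner_pmap
    by (rule glue_trivial[OF h A UA eval_hom[OF UA UA.one_closed] e1.homh c])
      (use comm[OF A.one_closed] a' b' in \<open>simp_all add: c01 at_inner_pmap\<close>)
  ultimately have "at_outer (UP (UP A)) \<one>\<^bsub>UP (UP A)\<^esub> G \<in> null_loops (UP A)"
    unfolding null_loops_def using G by auto
  moreover have "at_inner A \<zero>\<^bsub>A\<^esub> (at_outer (UP (UP A)) \<one>\<^bsub>UP (UP A)\<^esub> G) = v"
    using at_outer_pmap01(2)[OF pe0 UUA UA G(1)] by (simp add: G0 a' at_inner_pmap)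
  moreover have "at_inner A \<one>\<^bsub>A\<^esub> (at_outer (UP (UP A)) \<one>\<^bsub>UP (UP A)\<^esub> G) = w"
    using at_outer_pmap01(2)[OF pe1 UUA UA G(1)] by (simp add: G1 b' at_inner_pmap)
  ultimately show ?thesis by (rule that)
qed

text \<open>The null-homotopic quotients a' a^-1 and b' b^-1 are the two ends of a single loop u
  over A[X], so passing from (a, b) to (a', b') is a shift by u.\<close>

lemma chi_rep_cong:
  assumes a: "a \<in> loops A" and b: "b \<in> loops A" and a': "a' \<in> loops A" and b': "b' \<in> loops A"
    and "loop_class A a' = loop_class A a" "loop_class A b' = loop_class A b"
  shows "Gam_class (B_ring A) (chi_rep A a' b') = Gam_class (B_ring A) (chi_rep A a b)"
proof -
  note c = loopsD(1)[OF a] loopsD(1)[OF b] loopsD(1)[OF a'] loopsD(1)[OF b']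
  have "a' \<otimes>\<^bsub>SL2 (UP A)\<^esub> inv\<^bsub>SL2 (UP A)\<^esub> a \<in> null_loops A" "b' \<otimes>\<^bsub>SL2 (UP A)\<^esub> inv\<^bsub>SL2 (UP A)\<^esub> b \<in> null_loops A"
    using assms c by (simp_all add: loop_class_rcos[OF A] normal.rcos_eq_iff[OF normal_null_loops[OF A]])
  then obtain u where u: "u \<in> null_loops (UP A)" "at_inner A \<zero>\<^bsub>A\<^esub> u = a' \<otimes>\<^bsub>SL2 (UP A)\<^esub> inv\<^bsub>SL2 (UP A)\<^esub> a"
    "at_inner A \<one>\<^bsub>A\<^esub> u = b' \<otimes>\<^bsub>SL2 (UP A)\<^esub> inv\<^bsub>SL2 (UP A)\<^esub> b"
    by (rule null_loops_extend)
  show ?thesis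
    by (rule chi_rep_shift[OF subsetD[OF null_loops_subset[OF UA.is_cring] u(1)] a b])
      (use c in \<open>simp_all add: u G1.m_assoc\<close>)
qed

section \<open>Values of the maps on classes\<close>

lemma Psi1_class:
  assumes "w \<in> loops (B_ring A)"
  shows "Psi1 A (loop_class (B_ring A) w) = (loop_class (UP A) (map_mat2 (pmap fst) w), loop_class A (map_mat2 (pmap snd) w))"
  unfolding Psi1_def fst_pmat_pmap snd_pmat_pmap
  by (intro arg_cong2[of _ _ _ _ Pair] UN_const[OF loop_class_self[OF B.P assms]]
      loop_class_map_cong[OF B.f B.P UA.is_cring] loop_class_map_cong[OF B.g B.P A]
      loop_classD[OF B.P assms] assms) assumption+

lemma Psi2_rep:
  assumes "a \<in> loops (UP A)" "b \<in> loops A"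
  shows "Psi2_rep A a b \<in> loops (RDirProd A A)"
    "map_mat2 (pmap fst) (Psi2_rep A a b) = at_inner A \<zero>\<^bsub>A\<^esub> a \<otimes>\<^bsub>SL2 (UP A)\<^esub> inv\<^bsub>SL2 (UP A)\<^esub> b"
    "map_mat2 (pmap snd) (Psi2_rep A a b) = at_inner A \<one>\<^bsub>A\<^esub> a \<otimes>\<^bsub>SL2 (UP A)\<^esub> inv\<^bsub>SL2 (UP A)\<^esub> b"
  unfolding Psi2_rep_def
  by (intro pair_UP_prod subgroup.m_closed[OF subgroup_loops[OF A]] subgroup.m_inv_closed[OF subgroup_loops[OF A]]
      loops_inner assms)+

text \<open>Classes over the product ring can be compared in each factor, and there products and
  inverses respect the cosets of \<open>null_loops A\<close>.\<close>

lemma Psi2_class: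
  assumes a: "a \<in> loops (UP A)" and b: "b \<in> loops A"
  shows "Psi2 A (loop_class (UP A) a, loop_class A b) = loop_class (RDirProd A A) (Psi2_rep A a b)"
proof -
  interpret N: normal "null_loops A" "SL2 (UP A)" by (rule normal_null_loops[OF A])
  interpret L: subgroup "loops A" "SL2 (UP A)" by (rule subgroup_loops[OF A])
  have "loop_class (RDirProd A A) (Psi2_rep A a' b') = loop_class (RDirProd A A) (Psi2_rep A a b)"
    if "a' \<in> loop_class (UP A) a" "b' \<in> loop_class A b" for a' b'
  proof -
    note a' = loop_classD[OF UA.is_cring a that(1)] and b' = loop_classD[OF A b that(2)]
    note i = loops_inner[OF a] loops_inner[OF a'(1)]
    note cl = i[THEN loopsD(1)] b[THEN loopsD(1)] b'(1)[THEN loopsD(1)]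
    have ib: "null_loops A #>\<^bsub>SL2 (UP A)\<^esub> inv\<^bsub>SL2 (UP A)\<^esub> b' = null_loops A #>\<^bsub>SL2 (UP A)\<^esub> inv\<^bsub>SL2 (UP A)\<^esub> b"
      using b' b cl by (intro N.rcos_inv_cong) (simp_all add: loop_class_rcos[OF A])
    have ia: "null_loops A #>\<^bsub>SL2 (UP A)\<^esub> at_inner A \<zero>\<^bsub>A\<^esub> a' = null_loops A #>\<^bsub>SL2 (UP A)\<^esub> at_inner A \<zero>\<^bsub>A\<^esub> a"
      "null_loops A #>\<^bsub>SL2 (UP A)\<^esub> at_inner A \<one>\<^bsub>A\<^esub> a' = null_loops A #>\<^bsub>SL2 (UP A)\<^esub> at_inner A \<one>\<^bsub>A\<^esub> a"
      using loop_class_map_cong[OF e0.homh UA.is_cring A a'(1) a a'(2)] loop_class_map_cong[OF e1.homh UA.is_cring A a'(1) a a'(2)] i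
      by (simp_all add: loop_class_rcos[OF A] flip: at_inner_pmap)
    show ?thesis
      by (rule P.loop_class_eqI[OF refl Psi2_rep(1)[OF a'(1) b'(1)] Psi2_rep(1)[OF a b]];
          unfold Psi2_rep(2,3)[OF a'(1) b'(1)] Psi2_rep(2,3)[OF a b])
        (use ia ib cl i b b' in \<open>simp_all add: loop_class_rcos[OF A] N.rcos_mult_cong\<close>)
  qed
  then show ?thesis
    unfolding Psi2_def prod.case by (intro UN2_const loop_class_self UA.is_cring A a b)
qed

lemma chi_class:
  assumes w: "w \<in> loops (RDirProd A A)"
  shows "chi A (loop_class (RDirProd A A) w) =
    Gam_class (B_ring A) (chi_rep A (map_mat2 (pmap fst) w) (map_mat2 (pmap snd) w))"
  unfolding chi_def fst_pmat_pmap snd_pmat_pmap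
proof (rule UN_const[OF loop_class_self[OF P.P w]])
  fix v assume "v \<in> loop_class (RDirProd A A) w"
  note v = loop_classD[OF P.P w this]
  show "Gam_class (B_ring A) (chi_rep A (map_mat2 (pmap fst) v) (map_mat2 (pmap snd) v)) =
    Gam_class (B_ring A) (chi_rep A (map_mat2 (pmap fst) w) (map_mat2 (pmap snd) w))"
    by (intro chi_rep_cong loops_map[OF P.f P.P A] loops_map[OF P.g P.P A]
        loop_class_map_cong[OF P.f P.P A] loop_class_map_cong[OF P.g P.P A] v w)
qed

lemma Phi1_class:
  assumes "w \<in> carrier (SL2 (B_ring A))"
  shows "Phi1 A (Gam_class (B_ring A) w) = (Gam_class (UP A) (map_mat2 fst w), Gam_class A (map_mat2 snd w))"
  unfolding Phi1_def
  by (intro arg_cong2[of _ _ _ _ Pair] UN_const[OF Gam_class_self[OF B.P assms]]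
      Gam_class_map_cong[OF B.f B.P UA.is_cring] Gam_class_map_cong[OF B.g B.P A]
      Gam_classD[OF B.P assms] assms) assumption+

lemma Phi2_rep:
  assumes "a \<in> carrier (SL2 (UP A))" "b \<in> carrier (SL2 A)"
  shows "Phi2_rep A a b \<in> carrier (SL2 (RDirProd A A))"
    "map_mat2 fst (Phi2_rep A a b) = at_outer A \<zero>\<^bsub>A\<^esub> a \<otimes>\<^bsub>SL2 A\<^esub> inv\<^bsub>SL2 A\<^esub> b"
    "map_mat2 snd (Phi2_rep A a b) = at_outer A \<one>\<^bsub>A\<^esub> a \<otimes>\<^bsub>SL2 A\<^esub> inv\<^bsub>SL2 A\<^esub> b"
  unfolding Phi2_rep_def using assms by (intro pair_P; simp)+

lemma Phi2_class:
  assumes a: "a \<in> carrier (SL2 (UP A))" and b: "b \<in> carrier (SL2 A)"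
  shows "Phi2 A (Gam_class (UP A) a, Gam_class A b) = Gam_class (RDirProd A A) (Phi2_rep A a b)"
proof -
  interpret N: normal "QL2 A" "SL2 A" by (rule normal_QL2[OF A])
  have "Gam_class (RDirProd A A) (Phi2_rep A a' b') = Gam_class (RDirProd A A) (Phi2_rep A a b)"
    if "a' \<in> Gam_class (UP A) a" "b' \<in> Gam_class A b" for a' b'
  proof -
    note a' = Gam_classD[OF UA.is_cring a that(1)] and b' = Gam_classD[OF A b that(2)]
    have ib: "QL2 A #>\<^bsub>SL2 A\<^esub> inv\<^bsub>SL2 A\<^esub> b' = QL2 A #>\<^bsub>SL2 A\<^esub> inv\<^bsub>SL2 A\<^esub> b"
      using b' b by (intro N.rcos_inv_cong) (simp_all add: Gam_class_def)
    have ia: "QL2 A #>\<^bsub>SL2 A\<^esub> at_outer A \<zero>\<^bsub>A\<^esub> a' = QL2 A #>\<^bsub>SL2 A\<^esub> at_outer A \<zero>\<^bsub>A\<^esub> a"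
      "QL2 A #>\<^bsub>SL2 A\<^esub> at_outer A \<one>\<^bsub>A\<^esub> a' = QL2 A #>\<^bsub>SL2 A\<^esub> at_outer A \<one>\<^bsub>A\<^esub> a"
      using Gam_class_map_cong[OF e0.homh UA.is_cring A a'(1) a a'(2)] Gam_class_map_cong[OF e1.homh UA.is_cring A a'(1) a a'(2)]
      by (simp_all add: Gam_class_def at_outer_def)
    show ?thesis
      by (rule P.Gam_class_eqI[OF refl Phi2_rep(1)[OF a'(1) b'(1)] Phi2_rep(1)[OF a b]];
          unfold Phi2_rep(2,3)[OF a'(1) b'(1)] Phi2_rep(2,3)[OF a b])
        (use ia ib a a' b b' in \<open>simp_all add: Gam_class_def N.rcos_mult_cong\<close>)
  qed
  then show ?thesis
    unfolding Phi2_def prod.case by (intro UN2_const Gam_class_self UA.is_cring A a b)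
qed

lemma at_inner_path:
  assumes "N \<in> paths (UP A)"
  shows "at_inner A \<zero>\<^bsub>A\<^esub> N \<in> paths A" "at_inner A \<one>\<^bsub>A\<^esub> N \<in> paths A"
    "at_outer A \<one>\<^bsub>A\<^esub> (at_inner A \<zero>\<^bsub>A\<^esub> N) = at_outer A \<zero>\<^bsub>A\<^esub> (at_outer (UP A) \<one>\<^bsub>UP A\<^esub> N)"
    "at_outer A \<one>\<^bsub>A\<^esub> (at_inner A \<one>\<^bsub>A\<^esub> N) = at_outer A \<one>\<^bsub>A\<^esub> (at_outer (UP A) \<one>\<^bsub>UP A\<^esub> N)"
  using at_outer_at_outer[OF A A.zero_closed pathsD(1)[OF assms]] at_outer_at_outer[OF A A.one_closed pathsD(1)[OF assms]]
    pathsD[OF assms] by (simp_all add: paths_def)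

lemma QL2I: "a \<in> paths R \<Longrightarrow> cring R \<Longrightarrow> at_outer R \<one>\<^bsub>R\<^esub> a = x \<Longrightarrow> x \<in> QL2 R"
  by (auto simp: QL2_image paths_def kernel_def)

lemma null_loops_prod_iff:
  assumes "x \<in> carrier (SL2 (UP (RDirProd A A)))"
  shows "x \<in> null_loops (RDirProd A A) \<longleftrightarrow>
    map_mat2 (pmap fst) x \<in> null_loops A \<and> map_mat2 (pmap snd) x \<in> null_loops A"
  using P.null_loops_pairI[OF refl assms] null_loops_map[OF P.f P.P A] null_loops_map[OF P.g P.P A] by blast

lemma QL2_prod_iff:
  assumes "x \<in> carrier (SL2 (RDirProd A A))"
  shows "x \<in> QL2 (RDirProd A A) \<longleftrightarrow> map_mat2 fst x \<in> QL2 A \<and> map_mat2 snd x \<in> QL2 A"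
  using P.QL2_prodI[OF refl assms] QL2_map[OF P.f P.P A] QL2_map[OF P.g P.P A] by blast

section \<open>Exactness at the four interior terms\<close>

lemma Psi1_closed: "Psi1 A \<in> carrier (pi1 (B_ring A)) \<rightarrow> carrier (pi1 (UP A) \<times>\<times> pi1 A)"
  using loops_map[OF B.f B.P UA.is_cring] loops_map[OF B.g B.P A] by (auto simp: carrier_pi1 Psi1_class)

lemma Psi2_closed: "Psi2 A \<in> carrier (pi1 (UP A) \<times>\<times> pi1 A) \<rightarrow> carrier (pi1 (RDirProd A A))"
  using Psi2_rep(1) by (auto simp: carrier_pi1 Psi2_class)

lemma chi_closed: "chi A \<in> carrier (pi1 (RDirProd A A)) \<rightarrow> carrier (Gam (B_ring A))"
  using chi_rep(1) loops_map[OF P.f P.P A] loops_map[OF P.g P.P A]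
  by (auto simp: carrier_pi1 carrier_Gam chi_class)

lemma Phi1_closed: "Phi1 A \<in> carrier (Gam (B_ring A)) \<rightarrow> carrier (Gam (UP A) \<times>\<times> Gam A)"
  by (auto simp: carrier_Gam Phi1_class)

lemma Phi2_closed: "Phi2 A \<in> carrier (Gam (UP A) \<times>\<times> Gam A) \<rightarrow> carrier (Gam (RDirProd A A))"
  using Phi2_rep(1) by (auto simp: carrier_Gam Phi2_class)

lemma exact_Psi1_Psi2:
  "exact_at (pi1 (B_ring A)) (pi1 (UP A) \<times>\<times> pi1 A) (pi1 (RDirProd A A)) (Psi1 A) (Psi2 A)"
proof -
  interpret N: normal "null_loops A" "SL2 (UP A)" by (rule normal_null_loops[OF A])
  interpret NU: normal "null_loops (UP A)" "SL2 (UP (UP A))" by (rule normal_null_loops[OF UA.is_cring])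
  interpret LU: subgroup "loops (UP A)" "SL2 (UP (UP A))" by (rule subgroup_loops[OF UA.is_cring])
  have Psi2_one: "Psi2 A (loop_class (UP A) a, loop_class A b) = \<one>\<^bsub>pi1 (RDirProd A A)\<^esub> \<longleftrightarrow>
      at_inner A \<zero>\<^bsub>A\<^esub> a \<otimes>\<^bsub>SL2 (UP A)\<^esub> inv\<^bsub>SL2 (UP A)\<^esub> b \<in> null_loops A \<and>
      at_inner A \<one>\<^bsub>A\<^esub> a \<otimes>\<^bsub>SL2 (UP A)\<^esub> inv\<^bsub>SL2 (UP A)\<^esub> b \<in> null_loops A"
    if "a \<in> loops (UP A)" "b \<in> loops A" for a b
    using Psi2_rep[OF that] loopsD(1)[OF Psi2_rep(1)[OF that]]
    by (simp add: Psi2_class[OF that] loop_class_eq_one[OF P.P] null_loops_prod_iff)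
  have "Psi1 A ` carrier (pi1 (B_ring A)) \<subseteq> kernel (pi1 (UP A) \<times>\<times> pi1 A) (pi1 (RDirProd A A)) (Psi2 A)"
  proof (rule image_subsetI)
    fix c assume "c \<in> carrier (pi1 (B_ring A))"
    then obtain w where w: "w \<in> loops (B_ring A)" "c = loop_class (B_ring A) w" by (auto simp: carrier_pi1)
    note fg = loops_map[OF B.f B.P UA.is_cring w(1)] loops_map[OF B.g B.P A w(1)]
    \<comment> \<open>For a loop over B both ends in X equal the second component, so the two
      quotients are the identity.\<close>
    show "Psi1 A c \<in> kernel (pi1 (UP A) \<times>\<times> pi1 A) (pi1 (RDirProd A A)) (Psi2 A)"
      using fg loopsD(1)[OF fg(2)]
      by (simp add: kernel_def carrier_pi1 w(2) Psi1_class[OF w(1)] Psi2_one[OF fg] SL2_UB(2,3)[OF loopsD(1)[OF w(1)]])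
  qed
  moreover have "z \<in> Psi1 A ` carrier (pi1 (B_ring A))"
    if mem: "z \<in> kernel (pi1 (UP A) \<times>\<times> pi1 A) (pi1 (RDirProd A A)) (Psi2 A)" for z
  proof -
    obtain a b where a: "a \<in> loops (UP A)" and b: "b \<in> loops A" and z: "z = (loop_class (UP A) a, loop_class A b)"
      using mem by (auto simp: kernel_def carrier_pi1)
    have "at_inner A \<zero>\<^bsub>A\<^esub> a \<otimes>\<^bsub>SL2 (UP A)\<^esub> inv\<^bsub>SL2 (UP A)\<^esub> b \<in> null_loops A"
      "at_inner A \<one>\<^bsub>A\<^esub> a \<otimes>\<^bsub>SL2 (UP A)\<^esub> inv\<^bsub>SL2 (UP A)\<^esub> b \<in> null_loops A"
      using mem by (simp_all add: kernel_def z Psi2_one[OF a b])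
    then obtain u where u: "u \<in> null_loops (UP A)"
      "at_inner A \<zero>\<^bsub>A\<^esub> u = at_inner A \<zero>\<^bsub>A\<^esub> a \<otimes>\<^bsub>SL2 (UP A)\<^esub> inv\<^bsub>SL2 (UP A)\<^esub> b"
      "at_inner A \<one>\<^bsub>A\<^esub> u = at_inner A \<one>\<^bsub>A\<^esub> a \<otimes>\<^bsub>SL2 (UP A)\<^esub> inv\<^bsub>SL2 (UP A)\<^esub> b"
      by (rule null_loops_extend)
    note ul = subsetD[OF null_loops_subset[OF UA.is_cring] u(1)]
    note cl = loopsD(1)[OF a] loopsD(1)[OF b] loopsD(1)[OF ul]
    \<comment> \<open>The ends of u are a(0) b^-1 and a(1) b^-1, so both ends of u^-1 a are b. As u
      is null-homotopic, the class of a does not change.\<close>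
    define a' where "a' = inv\<^bsub>SL2 (UP (UP A))\<^esub> u \<otimes>\<^bsub>SL2 (UP (UP A))\<^esub> a"
    have a': "a' \<in> loops (UP A)" using a ul by (simp add: a'_def)
    have i: "at_inner A \<zero>\<^bsub>A\<^esub> a' = b" "at_inner A \<one>\<^bsub>A\<^esub> a' = b"
      using cl by (simp_all add: a'_def u G1.inv_mult_group G1.m_assoc)
    note p = pair_UB[OF loopsD(1)[OF a'] cl(2) i]
    have pl: "pair_pmat a' b \<in> loops (B_ring A)" using p a' b by (simp add: B.loops_iff)
    have "loop_class (UP A) a' = loop_class (UP A) a"
      using cl u(1) by (simp add: loop_class_rcos[OF UA.is_cring] a a' NU.rcos_eq_iff loopsD(1)[OF a'])
        (simp add: a'_def G2.m_assoc cl)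
    then have "z = Psi1 A (loop_class (B_ring A) (pair_pmat a' b))" by (simp add: Psi1_class[OF pl] p z)
    then show ?thesis using pl by (auto simp: carrier_pi1)
  qed
  ultimately show ?thesis using Psi1_closed Psi2_closed by (auto simp: exact_at_def)
qed

lemma exact_Psi2_chi:
  "exact_at (pi1 (UP A) \<times>\<times> pi1 A) (pi1 (RDirProd A A)) (Gam (B_ring A)) (Psi2 A) (chi A)"
proof -
  have 1: "\<one>\<^bsub>SL2 (UP A)\<^esub> \<in> loops A" by (rule one_in_loops[OF A])
  note M1 = chi_M[OF loops_paths[OF 1] loops_paths[OF 1]]
  \<comment> \<open>The M belonging to two trivial loops has both ends trivial, so it is itself a
    path in SL_2(B).\<close>
  have "chi_rep A \<one>\<^bsub>SL2 (UP A)\<^esub> \<one>\<^bsub>SL2 (UP A)\<^esub> \<in> QL2 (B_ring A)"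
    using QL2_B_I[of "chi_M A \<one>\<^bsub>SL2 (UP A)\<^esub> \<one>\<^bsub>SL2 (UP A)\<^esub>", OF _ M1(3,4)] M1
    by (simp add: chi_rep_def paths_def)
  then have triv: "Gam_class (B_ring A) (chi_rep A \<one>\<^bsub>SL2 (UP A)\<^esub> \<one>\<^bsub>SL2 (UP A)\<^esub>) = \<one>\<^bsub>Gam (B_ring A)\<^esub>"
    by (simp add: Gam_class_eq_one[OF B.P chi_rep(1)[OF 1 1]])
  have "chi A (Psi2 A c) = \<one>\<^bsub>Gam (B_ring A)\<^esub>" if mem: "c \<in> carrier (pi1 (UP A) \<times>\<times> pi1 A)" for c
  proof -
    obtain a b where a: "a \<in> loops (UP A)" and b: "b \<in> loops A" and c: "c = (loop_class (UP A) a, loop_class A b)"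
      using mem by (auto simp: carrier_pi1)
    \<comment> \<open>With b made constant in X, the ends of u are exactly the two components of
      \<open>Psi2_rep A a b\<close>, a shift of the pair (1, 1).\<close>
    define u where "u = a \<otimes>\<^bsub>SL2 (UP (UP A))\<^esub> inv\<^bsub>SL2 (UP (UP A))\<^esub> map_mat2 (pmap (cst A)) b"
    have u: "u \<in> loops (UP A)"
      unfolding u_def using subgroup_loops[OF UA.is_cring] a loops_const[OF b]
      by (intro subgroup.m_closed subgroup.m_inv_closed)
    have "Gam_class (B_ring A) (chi_rep A (at_inner A \<zero>\<^bsub>A\<^esub> a \<otimes>\<^bsub>SL2 (UP A)\<^esub> inv\<^bsub>SL2 (UP A)\<^esub> b)
        (at_inner A \<one>\<^bsub>A\<^esub> a \<otimes>\<^bsub>SL2 (UP A)\<^esub> inv\<^bsub>SL2 (UP A)\<^esub> b)) = \<one>\<^bsub>Gam (B_ring A)\<^esub>"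
      unfolding triv[symmetric]
      by (rule chi_rep_shift[OF u 1 1])
        (use loopsD(1)[OF a] loopsD(1)[OF b] in \<open>simp_all add: u_def at_inner_const\<close>)
    then show ?thesis
      by (simp add: c Psi2_class[OF a b] chi_class[OF Psi2_rep(1)[OF a b]] Psi2_rep[OF a b])
  qed
  then have "Psi2 A ` carrier (pi1 (UP A) \<times>\<times> pi1 A) \<subseteq> kernel (pi1 (RDirProd A A)) (Gam (B_ring A)) (chi A)"
    using Psi2_closed by (auto simp: kernel_def)
  moreover have "z \<in> Psi2 A ` carrier (pi1 (UP A) \<times>\<times> pi1 A)"
    if mem: "z \<in> kernel (pi1 (RDirProd A A)) (Gam (B_ring A)) (chi A)" for z
  proof -
    obtain w where w: "w \<in> loops (RDirProd A A)" and z: "z = loop_class (RDirProd A A) w"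
      using mem by (auto simp: kernel_def carrier_pi1)
    define a where "a = map_mat2 (pmap fst) w"
    define b where "b = map_mat2 (pmap snd) w"
    have a: "a \<in> loops A" and b: "b \<in> loops A"
      unfolding a_def b_def by (rule loops_map[OF P.f P.P A w] loops_map[OF P.g P.P A w])+
    note M = chi_M[OF loops_paths[OF a] loops_paths[OF b]]
    note rep = chi_rep[OF a b]
    have "chi_rep A a b \<in> QL2 (B_ring A)"
      using mem by (simp add: kernel_def z chi_class[OF w] Gam_class_eq_one[OF B.P] rep flip: a_def b_def)
    then obtain N d where N: "N \<in> paths (UP A)" "at_inner A \<zero>\<^bsub>A\<^esub> N = d" "at_inner A \<one>\<^bsub>A\<^esub> N = d"
      "at_outer (UP A) \<one>\<^bsub>UP A\<^esub> N = map_mat2 fst (chi_rep A a b)" "at_outer A \<one>\<^bsub>A\<^esub> d = map_mat2 snd (chi_rep A a b)"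
      and d: "d \<in> paths A" by (rule QL2_B_E)
    note cl = pathsD[OF N(1)] pathsD[OF d] loopsD(1)[OF a] loopsD(1)[OF b]
    \<comment> \<open>The path d is closed because it ends at the second component of
      \<open>chi_rep\<close>, which is the identity.\<close>
    have dl: "inv\<^bsub>SL2 (UP A)\<^esub> d \<in> loops A" using cl N(5) by (simp add: loops_def rep)
    define \<alpha> where "\<alpha> = chi_M A a b \<otimes>\<^bsub>SL2 (UP (UP A))\<^esub> inv\<^bsub>SL2 (UP (UP A))\<^esub> N"
    have \<alpha>: "\<alpha> \<in> loops (UP A)" using M cl N(4) by (simp add: loops_def \<alpha>_def rep)
    \<comment> \<open>With d^-1 as second loop, \<open>Psi2\<close> multiplies the ends a d^-1 and b
      d^-1 by d, so w is recovered as a matrix and not merely up to homotopy.\<close>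
    have "Psi2_rep A \<alpha> (inv\<^bsub>SL2 (UP A)\<^esub> d) = w"
      by (rule PU.SL2_joint_inj[OF loopsD(1)[OF Psi2_rep(1)[OF \<alpha> dl]] loopsD(1)[OF w]])
        (use M cl N(2,3) in \<open>simp_all add: Psi2_rep[OF \<alpha> dl] flip: a_def b_def\<close>,
          use M cl N(2,3) in \<open>simp_all add: \<alpha>_def G1.m_assoc\<close>)
    then have "z = Psi2 A (loop_class (UP A) \<alpha>, loop_class A (inv\<^bsub>SL2 (UP A)\<^esub> d))"
      by (simp add: z Psi2_class[OF \<alpha> dl])
    then show ?thesis using \<alpha> dl by (auto simp: carrier_pi1)
  qed
  ultimately show ?thesis using chi_closed Psi2_closed by (auto simp: exact_at_def)
qed

lemma exact_chi_Phi1: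
  "exact_at (pi1 (RDirProd A A)) (Gam (B_ring A)) (Gam (UP A) \<times>\<times> Gam A) (chi A) (Phi1 A)"
proof -
  interpret Q: normal "QL2 A" "SL2 A" by (rule normal_QL2[OF A])
  have Phi1_one: "Phi1 A (Gam_class (B_ring A) x) = \<one>\<^bsub>Gam (UP A) \<times>\<times> Gam A\<^esub> \<longleftrightarrow>
      map_mat2 fst x \<in> QL2 (UP A) \<and> map_mat2 snd x \<in> QL2 A"
    if "x \<in> carrier (SL2 (B_ring A))" for x
    using that by (simp add: Phi1_class Gam_class_eq_one UA.is_cring A)
  have "Phi1 A (chi A c) = \<one>\<^bsub>Gam (UP A) \<times>\<times> Gam A\<^esub>" if mem: "c \<in> carrier (pi1 (RDirProd A A))" for c
  proof -
    obtain w where w: "w \<in> loops (RDirProd A A)" and c: "c = loop_class (RDirProd A A) w"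
      using mem by (auto simp: carrier_pi1)
    note ab = loops_map[OF P.f P.P A w] loops_map[OF P.g P.P A w]
    note M = chi_M[OF loops_paths[OF ab(1)] loops_paths[OF ab(2)]]
    \<comment> \<open>Over A[X] alone the ends of M need not agree, so M itself connects the
      identity to M(X,1).\<close>
    have "at_outer (UP A) \<one>\<^bsub>UP A\<^esub> (chi_M A (map_mat2 (pmap fst) w) (map_mat2 (pmap snd) w)) \<in> QL2 (UP A)"
      by (rule QL2I[OF _ UA.is_cring refl]) (simp add: paths_def M)
    then show ?thesis
      by (simp add: c chi_class[OF w] Phi1_one[OF chi_rep(1)[OF ab]] chi_rep[OF ab] del: one_DirProd)
  qed
  then have "chi A ` carrier (pi1 (RDirProd A A)) \<subseteq> kernel (Gam (B_ring A)) (Gam (UP A) \<times>\<times> Gam A) (Phi1 A)"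
    using chi_closed by (auto simp: kernel_def)
  moreover have "z \<in> chi A ` carrier (pi1 (RDirProd A A))"
    if mem: "z \<in> kernel (Gam (B_ring A)) (Gam (UP A) \<times>\<times> Gam A) (Phi1 A)" for z
  proof -
    obtain x where x: "x \<in> carrier (SL2 (B_ring A))" and z: "z = Gam_class (B_ring A) x"
      using mem by (auto simp: kernel_def carrier_Gam)
    have "map_mat2 fst x \<in> QL2 (UP A)" "map_mat2 snd x \<in> QL2 A"
      using mem Phi1_one[OF x] by (simp_all add: kernel_def z)
    then obtain N d where N: "N \<in> paths (UP A)" "at_outer (UP A) \<one>\<^bsub>UP A\<^esub> N = map_mat2 fst x"
      and d: "d \<in> paths A" "at_outer A \<one>\<^bsub>A\<^esub> d = map_mat2 snd x"
      by (meson QL2E)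
    note i = at_inner_path[OF N(1)]
    note cl = pathsD[OF N(1)] pathsD[OF d(1)] pathsD[OF i(1)] pathsD[OF i(2)]
    define a where "a = inv\<^bsub>SL2 (UP A)\<^esub> d \<otimes>\<^bsub>SL2 (UP A)\<^esub> at_inner A \<zero>\<^bsub>A\<^esub> N"
    define b where "b = inv\<^bsub>SL2 (UP A)\<^esub> d \<otimes>\<^bsub>SL2 (UP A)\<^esub> at_inner A \<one>\<^bsub>A\<^esub> N"
    \<comment> \<open>Closedness holds because x lies over B: N(0,1) and N(1,1) are the two ends of
      its first component, both equal to its second component d(1).\<close>
    have a: "a \<in> loops A" and b: "b \<in> loops A"
      using cl x by (simp_all add: a_def b_def loops_def i N(2) d(2) SL2_B(2,3)[OF x])
    note M = chi_M[OF loops_paths[OF a] loops_paths[OF b]]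
    define K where "K = chi_M A a b \<otimes>\<^bsub>SL2 (UP (UP A))\<^esub> inv\<^bsub>SL2 (UP (UP A))\<^esub> N"
    have K: "K \<in> paths (UP A)" using M cl by (simp add: K_def paths_def)
    \<comment> \<open>The ends of N cancel against those in a and b and leave d^-1, whose value at T
      = 1 is the inverse of the second component of x. This is the quotient required, since the
      second component of \<open>chi_rep\<close> is 1.\<close>
    have Ki: "at_inner A \<zero>\<^bsub>A\<^esub> K = inv\<^bsub>SL2 (UP A)\<^esub> d" "at_inner A \<one>\<^bsub>A\<^esub> K = inv\<^bsub>SL2 (UP A)\<^esub> d"
      using M cl by (simp_all add: K_def a_def b_def G1.m_assoc)
    have "Gam_class (B_ring A) (chi_rep A a b) = z"
      unfolding z
      by (rule Gam_class_B_eqI[OF chi_rep(1)[OF a b] x K Ki])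
        (use M cl x in \<open>simp_all add: K_def chi_rep[OF a b] N(2) d(2)\<close>)
    then have "z = chi A (loop_class (RDirProd A A) (pair_pmat a b))"
      by (simp add: chi_class[OF pair_UP_prod(1)[OF a b]] pair_UP_prod[OF a b])
    then show ?thesis using pair_UP_prod(1)[OF a b] by (auto simp: carrier_pi1)
  qed
  ultimately show ?thesis using chi_closed Phi1_closed by (auto simp: exact_at_def)
qed

lemma exact_Phi1_Phi2:
  "exact_at (Gam (B_ring A)) (Gam (UP A) \<times>\<times> Gam A) (Gam (RDirProd A A)) (Phi1 A) (Phi2 A)"
proof -
  interpret Q: normal "QL2 A" "SL2 A" by (rule normal_QL2[OF A])
  interpret QU: normal "QL2 (UP A)" "SL2 (UP A)" by (rule normal_QL2[OF UA.is_cring])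
  have Phi2_one: "Phi2 A (Gam_class (UP A) a, Gam_class A b) = \<one>\<^bsub>Gam (RDirProd A A)\<^esub> \<longleftrightarrow>
      at_outer A \<zero>\<^bsub>A\<^esub> a \<otimes>\<^bsub>SL2 A\<^esub> inv\<^bsub>SL2 A\<^esub> b \<in> QL2 A \<and> at_outer A \<one>\<^bsub>A\<^esub> a \<otimes>\<^bsub>SL2 A\<^esub> inv\<^bsub>SL2 A\<^esub> b \<in> QL2 A"
    if "a \<in> carrier (SL2 (UP A))" "b \<in> carrier (SL2 A)" for a b
    using Phi2_rep[OF that] by (simp add: Phi2_class[OF that] Gam_class_eq_one[OF P.P] QL2_prod_iff)
  have "Phi1 A ` carrier (Gam (B_ring A)) \<subseteq> kernel (Gam (UP A) \<times>\<times> Gam A) (Gam (RDirProd A A)) (Phi2 A)"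
  proof (rule image_subsetI)
    fix c assume "c \<in> carrier (Gam (B_ring A))"
    then obtain x where x: "x \<in> carrier (SL2 (B_ring A))" "c = Gam_class (B_ring A) x" by (auto simp: carrier_Gam)
    note fg = B.F.hom_closed[OF x(1)] B.G.hom_closed[OF x(1)]
    show "Phi1 A c \<in> kernel (Gam (UP A) \<times>\<times> Gam A) (Gam (RDirProd A A)) (Phi2 A)"
      using fg by (simp add: kernel_def carrier_Gam x(2) Phi1_class[OF x(1)] Phi2_one[OF fg] SL2_B(2,3)[OF x(1)])
  qed
  moreover have "z \<in> Phi1 A ` carrier (Gam (B_ring A))"
    if mem: "z \<in> kernel (Gam (UP A) \<times>\<times> Gam A) (Gam (RDirProd A A)) (Phi2 A)" for z
  proof -
    obtain a b where a: "a \<in> carrier (SL2 (UP A))" and b: "b \<in> carrier (SL2 A)"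
      and z: "z = (Gam_class (UP A) a, Gam_class A b)"
      using mem by (auto simp: kernel_def carrier_Gam)
    have "at_outer A \<zero>\<^bsub>A\<^esub> a \<otimes>\<^bsub>SL2 A\<^esub> inv\<^bsub>SL2 A\<^esub> b \<in> QL2 A" "at_outer A \<one>\<^bsub>A\<^esub> a \<otimes>\<^bsub>SL2 A\<^esub> inv\<^bsub>SL2 A\<^esub> b \<in> QL2 A"
      using mem by (simp_all add: kernel_def z Phi2_one[OF a b])
    then obtain d e where d: "d \<in> paths A" "at_outer A \<one>\<^bsub>A\<^esub> d = at_outer A \<zero>\<^bsub>A\<^esub> a \<otimes>\<^bsub>SL2 A\<^esub> inv\<^bsub>SL2 A\<^esub> b"
      and e: "e \<in> paths A" "at_outer A \<one>\<^bsub>A\<^esub> e = at_outer A \<one>\<^bsub>A\<^esub> a \<otimes>\<^bsub>SL2 A\<^esub> inv\<^bsub>SL2 A\<^esub> b"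
      by (meson QL2E)
    note M = chi_M[OF d(1) e(1)]
    \<comment> \<open>The ends of m at X = 0 and X = 1 are the end points of d and e, that is a(0)
      b^-1 and a(1) b^-1.\<close>
    define m where "m = at_outer (UP A) \<one>\<^bsub>UP A\<^esub> (chi_M A d e)"
    have Mp: "chi_M A d e \<in> paths (UP A)" using M by (simp add: paths_def)
    have m: "m \<in> carrier (SL2 (UP A))" using M by (simp add: m_def)
    have mQ: "m \<in> QL2 (UP A)" unfolding m_def by (rule QL2I[OF Mp UA.is_cring refl])
    have mi: "at_outer A \<zero>\<^bsub>A\<^esub> m = at_outer A \<zero>\<^bsub>A\<^esub> a \<otimes>\<^bsub>SL2 A\<^esub> inv\<^bsub>SL2 A\<^esub> b"
      "at_outer A \<one>\<^bsub>A\<^esub> m = at_outer A \<one>\<^bsub>A\<^esub> a \<otimes>\<^bsub>SL2 A\<^esub> inv\<^bsub>SL2 A\<^esub> b"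
      using at_inner_path(3,4)[OF Mp] M d(2) e(2) by (simp_all add: m_def)
    define a' where "a' = inv\<^bsub>SL2 (UP A)\<^esub> m \<otimes>\<^bsub>SL2 (UP A)\<^esub> a"
    have a': "a' \<in> carrier (SL2 (UP A))" using a m by (simp add: a'_def)
    have "at_outer A \<zero>\<^bsub>A\<^esub> a' = b" "at_outer A \<one>\<^bsub>A\<^esub> a' = b"
      using a b m by (simp_all add: a'_def mi G0.inv_mult_group G0.m_assoc)
    note p = pair_B[OF a' b this]
    \<comment> \<open>Classes are right cosets, which absorb a factor on the left; this is why a is
      corrected by m^-1 on that side.\<close>
    have "Gam_class (UP A) a' = Gam_class (UP A) a"
      using a m mQ a' by (simp add: Gam_class_def QU.rcos_eq_iff) (simp add: a'_def G1.m_assoc a m mQ)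
    then have "z = Phi1 A (Gam_class (B_ring A) (pair_mat a' b))" by (simp add: Phi1_class p z)
    then show ?thesis using p(1) by (auto simp: carrier_Gam)
  qed
  ultimately show ?thesis using Phi1_closed Phi2_closed by (auto simp: exact_at_def)
qed

section \<open>The formulas for the maps on pairs of representatives\<close>

lemma Psi1_pair:
  assumes "\<alpha> \<in> loops (UP A)" "\<beta> \<in> loops A"
    and "at_inner A \<zero>\<^bsub>A\<^esub> \<alpha> = \<beta>" "at_inner A \<one>\<^bsub>A\<^esub> \<alpha> = \<beta>"
  shows "pair_pmat \<alpha> \<beta> \<in> loops (B_ring A)"
    and "Psi1 A (loop_class (B_ring A) (pair_pmat \<alpha> \<beta>)) = (loop_class (UP A) \<alpha>, loop_class A \<beta>)"
proof -
  note p = pair_UB[OF loopsD(1)[OF assms(1)] loopsD(1)[OF assms(2)] assms(3,4)]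
  show "pair_pmat \<alpha> \<beta> \<in> loops (B_ring A)" using p assms(1,2) by (simp add: B.loops_iff)
  then show "Psi1 A (loop_class (B_ring A) (pair_pmat \<alpha> \<beta>)) = (loop_class (UP A) \<alpha>, loop_class A \<beta>)"
    by (simp add: Psi1_class p)
qed

lemma chi_pair:
  assumes "\<alpha> \<in> loops A" "\<beta> \<in> loops A"
  shows "chi A (loop_class (RDirProd A A) (pair_pmat \<alpha> \<beta>)) = Gam_class (B_ring A) (chi_rep A \<alpha> \<beta>)"
  by (simp add: chi_class[OF pair_UP_prod(1)[OF assms]] pair_UP_prod[OF assms])

lemma Phi1_pair:
  assumes "\<alpha> \<in> carrier (SL2 (UP A))" "\<beta> \<in> carrier (SL2 A)" "at_outer A \<zero>\<^bsub>A\<^esub> \<alpha> = \<beta>" "at_outer A \<one>\<^bsub>A\<^esub> \<alpha> = \<beta>"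
  shows "Phi1 A (Gam_class (B_ring A) (pair_mat \<alpha> \<beta>)) = (Gam_class (UP A) \<alpha>, Gam_class A \<beta>)"
  by (simp add: Phi1_class pair_B[OF assms])

end

text \<open>The formulas stand next to exactness because the maps are defined as unions: they
  certify that each union is a single class, given by the expected representative.\<close>

theorem theorem2p3:
  fixes A :: "('a, 'm) ring_scheme"
  assumes "cring A"
  shows
   "(\<forall>\<alpha> \<in> loops (UP A). \<forall>\<beta> \<in> loops A.
       at_inner A \<zero>\<^bsub>A\<^esub> \<alpha> = \<beta> \<and> at_inner A \<one>\<^bsub>A\<^esub> \<alpha> = \<beta> \<longrightarrow>
         pair_pmat \<alpha> \<beta> \<in> loops (B_ring A) \<and>
         Psi1 A (loop_class (B_ring A) (pair_pmat \<alpha> \<beta>)) = (loop_class (UP A) \<alpha>, loop_class A \<beta>)) \<and>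
    (\<forall>\<alpha> \<in> loops (UP A). \<forall>\<beta> \<in> loops A.
       Psi2 A (loop_class (UP A) \<alpha>, loop_class A \<beta>) =
         loop_class (RDirProd A A)
           (pair_pmat (at_inner A \<zero>\<^bsub>A\<^esub> \<alpha> \<otimes>\<^bsub>SL2 (UP A)\<^esub> inv\<^bsub>SL2 (UP A)\<^esub> \<beta>)
                      (at_inner A \<one>\<^bsub>A\<^esub> \<alpha> \<otimes>\<^bsub>SL2 (UP A)\<^esub> inv\<^bsub>SL2 (UP A)\<^esub> \<beta>))) \<and>
    (\<forall>\<alpha> \<in> loops A. \<forall>\<beta> \<in> loops A.
       pair_pmat \<alpha> \<beta> \<in> loops (RDirProd A A) \<and>
       chi A (loop_class (RDirProd A A) (pair_pmat \<alpha> \<beta>)) =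
         Gam_class (B_ring A)
           (pair_mat (at_outer (UP A) \<one>\<^bsub>UP A\<^esub> (chi_M A \<alpha> \<beta>)) \<one>\<^bsub>SL2 A\<^esub>)) \<and>
    (\<forall>\<alpha> \<in> carrier (SL2 (UP A)). \<forall>\<beta> \<in> carrier (SL2 A).
       at_outer A \<zero>\<^bsub>A\<^esub> \<alpha> = \<beta> \<and> at_outer A \<one>\<^bsub>A\<^esub> \<alpha> = \<beta> \<longrightarrow>
         pair_mat \<alpha> \<beta> \<in> carrier (SL2 (B_ring A)) \<and>
         Phi1 A (Gam_class (B_ring A) (pair_mat \<alpha> \<beta>)) = (Gam_class (UP A) \<alpha>, Gam_class A \<beta>)) \<and>
    (\<forall>\<alpha> \<in> carrier (SL2 (UP A)). \<forall>\<beta> \<in> carrier (SL2 A).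
       Phi2 A (Gam_class (UP A) \<alpha>, Gam_class A \<beta>) =
         Gam_class (RDirProd A A)
           (pair_mat (at_outer A \<zero>\<^bsub>A\<^esub> \<alpha> \<otimes>\<^bsub>SL2 A\<^esub> inv\<^bsub>SL2 A\<^esub> \<beta>)
                     (at_outer A \<one>\<^bsub>A\<^esub> \<alpha> \<otimes>\<^bsub>SL2 A\<^esub> inv\<^bsub>SL2 A\<^esub> \<beta>))) \<and>
    exact_at (pi1 (B_ring A)) (pi1 (UP A) \<times>\<times> pi1 A) (pi1 (RDirProd A A)) (Psi1 A) (Psi2 A) \<and>
    exact_at (pi1 (UP A) \<times>\<times> pi1 A) (pi1 (RDirProd A A)) (Gam (B_ring A)) (Psi2 A) (chi A) \<and>
    exact_at (pi1 (RDirProd A A)) (Gam (B_ring A)) (Gam (UP A) \<times>\<times> Gam A) (chi A) (Phi1 A) \<and>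
    exact_at (Gam (B_ring A)) (Gam (UP A) \<times>\<times> Gam A) (Gam (RDirProd A A)) (Phi1 A) (Phi2 A)"
  by (intro conjI ballI impI; (elim conjE)?)
    (rule Psi1_pair[OF assms] Psi2_class[OF assms, unfolded Psi2_rep_def] pair_UP_prod(1)[OF assms]
      chi_pair[OF assms, unfolded chi_rep_def] pair_B(1)[OF assms] Phi1_pair[OF assms]
      Phi2_class[OF assms, unfolded Phi2_rep_def] exact_Psi1_Psi2[OF assms] exact_Psi2_chi[OF assms]
      exact_chi_Phi1[OF assms] exact_Phi1_Phi2[OF assms]; assumption)+

end
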